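(* Let $W$ be the Weyl group of a Cartan matrix of finite type with index set $I$, and let $c$ be a Coxeter element of $W$. For every $i\in I$, the sum $h(i;c)+h(i^\star;c)$ is equal to the Coxeter number of the connected component of $I$ containing $i$ and $i^\star$.
   Context: $A=(a_{i,j})_{i,j\in I}$ is a Cartan matrix of finite type with simple roots $\alpha_i$, fundamental weights $\omega_i$ ($\alpha_j=\sum_i a_{i,j}\omega_i$), and Weyl group $W$ generated by simple reflections $s_i$, $s_i\alpha_j=\alpha_j-a_{i,j}\alpha_i$. A Coxeter element is a product of all simple reflections, each once, in some order. $I$ is regarded as the vertex set of the Coxeter graph, with $i\ne j$ joined by an edge iff $a_{i,j}\ne0$; the Coxeter number of a connected component is the order of any Coxeter element of the corresponding irreducible Weyl group. The involution $i\mapsto i^\star$ of $I$ is defined by $\omega_{i^\star}=-w_\circ(\omega_i)$, with $w_\circ$ the longest element of $W$. Weights are ordered by $\gamma\ge\delta$ iff $\gamma-\delta$ is a nonnegative integer combination of simple roots, and $h(i;c)$ is the (unique) positive integer with $\omega_i>c\,\omega_i>\cdots>c^{h(i;c)}\omega_i=-\omega_{i^\star}$. *)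

theory Defs
  imports "HOL-Analysis.Finite_Cartesian_Product" "HOL-Algebra.Algebra"
begin

text \<open>
  The index set of a Cartan matrix is the finite type \<open>'n\<close>.  Weights are the integer vectors
  \<open>\<mu> = (\<Sum>i. \<mu>\<^sub>i \<omega>\<^sub>i)\<close>, that is, coordinates always refer to the basis of fundamental weights.
\<close>

(* Finite type is expressed by a symmetrization D A, D a positive diagonal matrix, that is
   positive definite.  The symmetrization forces a_ij = 0 iff a_ji = 0. *)
definition cartan_finite_type :: "int^'n^'n \<Rightarrow> bool" where
  "cartan_finite_type A \<longleftrightarrow>
     (\<forall>i. A $ i $ i = 2) \<and>
     (\<forall>i j. i \<noteq> j \<longrightarrow> A $ i $ j \<le> 0) \<and>
     (\<exists>d :: 'n \<Rightarrow> real.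
        (\<forall>i. d i > 0) \<and>
        (\<forall>i j. d i * of_int (A $ i $ j) = d j * of_int (A $ j $ i)) \<and>
        (\<forall>x :: real^'n. x \<noteq> 0 \<longrightarrow>
           (\<Sum>i\<in>UNIV. \<Sum>j\<in>UNIV. d i * of_int (A $ i $ j) * x $ i * x $ j) > 0))"

definition fundamental_weight :: "'n \<Rightarrow> int^'n" where
  "fundamental_weight i = axis i 1"

definition simple_root :: "int^'n^'n \<Rightarrow> 'n \<Rightarrow> int^'n" where
  "simple_root A j = (\<Sum>i\<in>UNIV. A $ i $ j *s fundamental_weight i)"

(* The linear map with s_i (omega_j) = omega_j for j ~= i and s_i (omega_i) = omega_i - alpha_i;
   on simple roots it is given by simple_reflection_simple_root below. *)
definition simple_reflection :: "int^'n^'n \<Rightarrow> 'n \<Rightarrow> int^'n \<Rightarrow> int^'n" where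
  "simple_reflection A i \<mu> = \<mu> - \<mu> $ i *s simple_root A i"

lemma simple_root_nth: "simple_root A j $ k = A $ k $ j"
proof -
  have "simple_root A j $ k = (\<Sum>i\<in>UNIV. if i = k then A $ i $ j else 0)"
    unfolding simple_root_def fundamental_weight_def
    by (simp only: sum_component) (rule sum.cong, auto simp: vector_scalar_mult_def axis_def)
  then show ?thesis by simp
qed

lemma simple_reflection_simple_root:
  "simple_reflection A i (simple_root A j) = simple_root A j - A $ i $ j *s simple_root A i"
  by (simp add: simple_reflection_def simple_root_nth)

lemma simple_reflection_involution:
  assumes "A $ i $ i = 2"
  shows "simple_reflection A i (simple_reflection A i \<mu>) = \<mu>"
  using assms
  by (simp add: simple_reflection_def vec_eq_iff simple_root_nth vector_scalar_mult_def algebra_simps)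

lemma simple_reflection_in_BijGroup:
  assumes "A $ i $ i = 2"
  shows "simple_reflection A i \<in> carrier (BijGroup UNIV)"
  using assms
  by (auto simp: BijGroup_def Bij_def intro!: o_bij[of "simple_reflection A i"]
           simp: fun_eq_iff simple_reflection_involution)

(* For a connected component J of the Coxeter graph this is the corresponding irreducible Weyl
   group: A_kj = 0 for j in J and k not in J, so s_j (j in J) acts on the coordinates in J as the
   simple reflection of the Cartan matrix (A_ij) with i, j in J, and fixes the other coordinates. *)
definition weyl_group :: "int^'n^'n \<Rightarrow> 'n set \<Rightarrow> (int^'n \<Rightarrow> int^'n) monoid" where
  "weyl_group A J = subgroup_generated (BijGroup UNIV) (simple_reflection A ` J)"

definition reflection_product :: "int^'n^'n \<Rightarrow> 'n list \<Rightarrow> int^'n \<Rightarrow> int^'n" where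
  "reflection_product A is = foldr (\<circ>) (map (simple_reflection A) is) id"

definition coxeter_elements :: "int^'n^'n \<Rightarrow> 'n set \<Rightarrow> (int^'n \<Rightarrow> int^'n) set" where
  "coxeter_elements A J = {reflection_product A is |is. distinct is \<and> set is = J}"

definition coxeter_edges :: "int^'n^'n \<Rightarrow> ('n \<times> 'n) set" where
  "coxeter_edges A = {(i, j). i \<noteq> j \<and> A $ i $ j \<noteq> 0}"

definition coxeter_component :: "int^'n^'n \<Rightarrow> 'n \<Rightarrow> 'n set" where
  "coxeter_component A i = {j. (i, j) \<in> (coxeter_edges A)\<^sup>*}"

definition coxeter_number :: "int^'n^'n \<Rightarrow> 'n set \<Rightarrow> nat" where
  "coxeter_number A J = (THE h. \<forall>c\<in>coxeter_elements A J. group.ord (weyl_group A J) c = h)"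

definition weyl_length :: "int^'n^'n \<Rightarrow> (int^'n \<Rightarrow> int^'n) \<Rightarrow> nat" where
  "weyl_length A w = (LEAST n. \<exists>is. length is = n \<and> reflection_product A is = w)"

definition longest_element :: "int^'n^'n \<Rightarrow> int^'n \<Rightarrow> int^'n" where
  "longest_element A =
     (THE w. w \<in> carrier (weyl_group A UNIV) \<and>
        (\<forall>v\<in>carrier (weyl_group A UNIV). v \<noteq> w \<longrightarrow> weyl_length A v < weyl_length A w))"

definition star :: "int^'n^'n \<Rightarrow> 'n \<Rightarrow> 'n" where
  "star A i = (THE j. fundamental_weight j = - longest_element A (fundamental_weight i))"

definition weight_ge :: "int^'n^'n \<Rightarrow> int^'n \<Rightarrow> int^'n \<Rightarrow> bool" where
  "weight_ge A \<gamma> \<delta> \<longleftrightarrow>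
     (\<exists>m :: 'n \<Rightarrow> nat. \<gamma> - \<delta> = (\<Sum>i\<in>UNIV. int (m i) *s simple_root A i))"

definition weight_gt :: "int^'n^'n \<Rightarrow> int^'n \<Rightarrow> int^'n \<Rightarrow> bool" where
  "weight_gt A \<gamma> \<delta> \<longleftrightarrow> weight_ge A \<gamma> \<delta> \<and> \<gamma> \<noteq> \<delta>"

definition chain_length :: "int^'n^'n \<Rightarrow> (int^'n \<Rightarrow> int^'n) \<Rightarrow> 'n \<Rightarrow> nat" where
  "chain_length A c i =
     (THE h. h > 0 \<and>
        (\<forall>k<h. weight_gt A ((c ^^ k) (fundamental_weight i)) ((c ^^ Suc k) (fundamental_weight i))) \<and>
        (c ^^ h) (fundamental_weight i) = - fundamental_weight (star A i))"

end

theory Submission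
  imports Defs "HOL-Analysis.Cartesian_Euclidean_Space"
begin

text \<open>
  Let \<open>h\<^sub>i\<close> be the length of the chain of \<open>\<omega>\<^sub>i\<close>.  Each \<open>\<beta>\<^sub>i = \<omega>\<^sub>i - c \<omega>\<^sub>i\<close> is a positive root, and the \<open>\<beta>\<^sub>i\<close> are
  exactly the positive roots made negative by \<open>c\<^sup>-\<^sup>1\<close>.  As \<open>c\<close> has no nonzero fixed vector, the orbit of
  \<open>\<beta>\<^sub>i\<close> turns negative, for the first time at \<open>- \<beta>\<^sub>j\<close>, which means \<open>c\<^sup>h \<omega>\<^sub>i = - \<omega>\<^sub>j\<close>; then \<open>j\<close> is the
  image of \<open>i\<close> under the star involution.  Hence \<open>\<omega>\<^sub>i\<close> has exact period \<open>h\<^sub>i + h\<^sub>j\<close> under \<open>c\<close>.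

  Adjacent fundamental weights have equal periods: \<open>\<omega>\<^sub>i + c \<omega>\<^sub>i\<close> is a nonnegative combination of the
  \<open>c \<omega>\<^sub>l\<close> with \<open>l\<close> before \<open>i\<close> and the \<open>\<omega>\<^sub>l\<close> with \<open>l\<close> after \<open>i\<close>.  If \<open>c\<^sup>k\<close> fixes \<open>\<omega>\<^sub>i\<close>, comparing coefficients of
  the simple roots after \<open>i\<close> shows that \<open>c\<^sup>k\<close> fixes every neighbouring \<open>\<omega>\<^sub>l\<close> with \<open>l\<close> after \<open>i\<close>; the
  others are handled by \<open>c\<^sup>-\<^sup>1\<close>.  So on a component \<open>J\<close> the Coxeter element has order \<open>N = h\<^sub>i + h\<^sub>j\<close>, and
  since the roots of \<open>J\<close> are the distinct \<open>c\<^sup>k \<beta>\<^sub>l\<close> with \<open>l\<close> in \<open>J\<close> and \<open>k < N\<close>, this order is the number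
  of roots divided by \<open>|J|\<close>, independently of the Coxeter element.
\<close>

section \<open>Linear action on weights and root coordinates\<close>

text \<open>Off-diagonal terms occur in equal pairs, so modulo 2 only the diagonal counts.\<close>

lemma even_sum_symmetric:
  fixes S :: "'a \<Rightarrow> 'a \<Rightarrow> int"
  assumes "finite F" "\<And>i j. S i j = S j i" "\<And>i. even (S i i)"
  shows "even (\<Sum>i\<in>F. \<Sum>j\<in>F. S i j)"
  using assms(1)
proof (induction F)
  case (insert x F)
  have "(\<Sum>i\<in>insert x F. \<Sum>j\<in>insert x F. S i j)
      = S x x + (\<Sum>j\<in>F. S x j) + (\<Sum>i\<in>F. S i x) + (\<Sum>i\<in>F. \<Sum>j\<in>F. S i j)"
    using insert by (simp add: sum.distrib)
  also have "(\<Sum>i\<in>F. S i x) = (\<Sum>j\<in>F. S x j)"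
    using assms(2) by simp
  finally show ?case using insert assms(3) by simp
qed simp

lemma finite_bounded_int_vec: "finite {m :: int^'n. \<forall>j. \<bar>m $ j\<bar> \<le> N}"
proof (rule finite_imageD)
  show "inj_on vec_nth {m :: int^'n. \<forall>j. \<bar>m $ j\<bar> \<le> N}"
    by (simp add: inj_on_def vec_nth_inject)
  have "vec_nth ` {m :: int^'n. \<forall>j. \<bar>m $ j\<bar> \<le> N} \<subseteq> PiE UNIV (\<lambda>_. {-N..N})"
    by (auto simp: abs_le_iff minus_le_iff)
  then show "finite (vec_nth ` {m :: int^'n. \<forall>j. \<bar>m $ j\<bar> \<le> N})"
    by (rule finite_subset) (intro finite_PiE; simp)
qed

section \<open>Reflections in weight coordinates and in root coordinates\<close>

text \<open>The simple reflection transported along \<open>A\<close> to the basis of simple roots,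
  where positivity of a root is the sign of its coefficients.\<close>

definition root_reflection :: "int^'n^'n \<Rightarrow> 'n \<Rightarrow> int^'n \<Rightarrow> int^'n" where
  "root_reflection A i m = m - (A *v m) $ i *s axis i 1"

definition root_product :: "int^'n^'n \<Rightarrow> 'n list \<Rightarrow> int^'n \<Rightarrow> int^'n" where
  "root_product A is = foldr (\<circ>) (map (root_reflection A) is) id"

text \<open>For root coordinates this is positivity, for a weight it is dominance.\<close>

definition nonneg :: "int^'n \<Rightarrow> bool" where
  "nonneg m \<longleftrightarrow> (\<forall>j. 0 \<le> m $ j)"

lemma root_reflection_nth:
  "root_reflection A i m $ j = (if j = i then m $ i - (A *v m) $ i else m $ j)"
  by (simp add: root_reflection_def axis_def)

lemma simple_reflection_nth:
  "simple_reflection A i \<mu> $ j = \<mu> $ j - \<mu> $ i * A $ j $ i"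
  by (simp add: simple_reflection_def simple_root_nth)

lemma fundamental_weight_nth: "fundamental_weight i $ j = (if j = i then 1 else 0)"
  by (simp add: fundamental_weight_def axis_def)

lemma mult_axis_nth: "((A :: int^'n^'n) *v axis i 1) $ j = A $ j $ i"
  by (simp add: matrix_vector_mult_def axis_def if_distrib[where f="\<lambda>x. _ * x"] cong: if_cong)

lemma mult_axis: "(A :: int^'n^'n) *v axis i 1 = simple_root A i"
  by (simp add: vec_eq_iff mult_axis_nth simple_root_nth)

lemma weight_expansion: "(\<mu> :: int^'n) = (\<Sum>i\<in>UNIV. \<mu> $ i *s fundamental_weight i)"
  by (simp add: vec_eq_iff fundamental_weight_nth if_distrib[where f="\<lambda>x. _ * x"] cong: if_cong)

lemma matrix_vector_mult_eq: "(A :: int^'n^'n) *v m = (\<Sum>i\<in>UNIV. m $ i *s simple_root A i)"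
  by (simp add: vec_eq_iff matrix_vector_mult_def simple_root_nth mult.commute)

lemma matrix_vector_mult_uminus: "(A :: int^'n^'n) *v (- m) = - (A *v m)"
  by (simp add: vec_eq_iff matrix_vector_mult_def sum_negf)

lemma matrix_vector_mult_add: "(A :: int^'n^'n) *v (m + n) = A *v m + A *v n"
  by (simp add: vec_eq_iff matrix_vector_mult_def sum.distrib algebra_simps)

lemma matrix_vector_mult_minus: "(A :: int^'n^'n) *v (m - n) = A *v m - A *v n"
  by (simp add: vec_eq_iff matrix_vector_mult_def sum_subtractf algebra_simps)

lemma matrix_vector_mult_scale: "(A :: int^'n^'n) *v (k *s m) = k *s (A *v m)"
  by (simp add: vec_eq_iff matrix_vector_mult_def sum_distrib_left algebra_simps)

lemma matrix_vector_mult_additive: "additive ((*v) (A :: int^'n^'n))"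
  by standard (rule matrix_vector_mult_add)

lemmas matrix_vector_mult_sum = additive.sum[OF matrix_vector_mult_additive]
lemmas matrix_vector_mult_zero = additive.zero[OF matrix_vector_mult_additive]

lemma reflection_product_simps [simp]:
  "reflection_product A [] = id"
  "reflection_product A (x # xs) = simple_reflection A x \<circ> reflection_product A xs"
  by (simp_all add: reflection_product_def)

lemma reflection_product_append [simp]:
  "reflection_product A (xs @ ys) = reflection_product A xs \<circ> reflection_product A ys"
  by (induction xs) (simp_all add: comp_assoc)

lemma reflection_product_power:
  "reflection_product A xs ^^ k = reflection_product A (concat (replicate k xs))"
  by (induction k) simp_all

lemma root_product_simps [simp]:
  "root_product A [] = id"
  "root_product A (x # xs) = root_reflection A x \<circ> root_product A xs"
  by (simp_all add: root_product_def)

lemma root_product_append [simp]: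
  "root_product A (xs @ ys) = root_product A xs \<circ> root_product A ys"
  by (induction xs) (simp_all add: comp_assoc)

lemma root_product_power:
  "root_product A xs ^^ k = root_product A (concat (replicate k xs))"
  by (induction k) simp_all

lemma reflection_product_add:
  "reflection_product A xs (\<mu> + \<nu>) = reflection_product A xs \<mu> + reflection_product A xs \<nu>"
  by (induction xs) (simp_all add: vec_eq_iff simple_reflection_nth algebra_simps)

lemma reflection_product_scale:
  "reflection_product A xs (k *s \<mu>) = k *s reflection_product A xs \<mu>"
  by (induction xs) (simp_all add: vec_eq_iff simple_reflection_nth algebra_simps)

lemma reflection_product_additive: "additive (reflection_product A xs)"
  by standard (rule reflection_product_add)

lemmas reflection_product_minus = additive.minus[OF reflection_product_additive]
lemmas reflection_product_diff = additive.diff[OF reflection_product_additive]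
lemmas reflection_product_sum = additive.sum[OF reflection_product_additive]

lemma root_reflection_add:
  "root_reflection A i (m + n) = root_reflection A i m + root_reflection A i n"
  by (simp add: vec_eq_iff root_reflection_nth matrix_vector_mult_add)

lemma root_reflection_scale: "root_reflection A i (k *s m) = k *s root_reflection A i m"
  by (simp add: vec_eq_iff root_reflection_nth matrix_vector_mult_scale right_diff_distrib)

lemma root_product_add:
  "root_product A xs (m + n) = root_product A xs m + root_product A xs n"
  by (induction xs) (simp_all add: root_reflection_add)

lemma root_product_scale:
  "root_product A xs (k *s m) = k *s root_product A xs m"
  by (induction xs) (simp_all add: root_reflection_scale)

lemma root_product_additive: "additive (root_product A xs)"
  by standard (rule root_product_add)

lemmas root_product_minus = additive.minus[OF root_product_additive]
lemmas root_product_sum = additive.sum[OF root_product_additive]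

lemma root_product_expansion:
  "root_product A xs m = (\<Sum>i\<in>UNIV. m $ i *s root_product A xs (axis i 1))"
proof -
  have "root_product A xs m = root_product A xs (\<Sum>i\<in>UNIV. m $ i *s axis i 1)"
    using weight_expansion[of m] by (simp add: fundamental_weight_def)
  then show ?thesis by (simp add: root_product_sum root_product_scale)
qed

lemma simple_reflection_mult:
  "simple_reflection A i (A *v m) = A *v root_reflection A i m"
  by (simp add: simple_reflection_def root_reflection_def matrix_vector_mult_minus
      matrix_vector_mult_scale mult_axis)

lemma reflection_product_mult: "reflection_product A xs (A *v m) = A *v root_product A xs m"
  by (induction xs) (simp_all add: simple_reflection_mult)

lemma root_product_nth_other: "j \<notin> set xs \<Longrightarrow> root_product A xs m $ j = m $ j"
  by (induction xs) (simp_all add: root_reflection_nth)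

lemma simple_reflection_fundamental:
  "simple_reflection A i (fundamental_weight i) = fundamental_weight i - A *v axis i 1"
  by (simp add: vec_eq_iff simple_reflection_nth fundamental_weight_nth mult_axis_nth)

lemma reflection_product_fixes:
  "(\<And>j. j \<in> set xs \<Longrightarrow> \<mu> $ j = 0) \<Longrightarrow> reflection_product A xs \<mu> = \<mu>"
  by (induction xs) (simp_all add: vec_eq_iff simple_reflection_nth)

lemma reflection_product_fundamental_other:
  "i \<notin> set xs \<Longrightarrow> reflection_product A xs (fundamental_weight i) = fundamental_weight i"
  by (rule reflection_product_fixes) (auto simp: fundamental_weight_nth)

text \<open>Each letter \<open>x\<close> changes its argument by a multiple of the simple root of
  \<open>x\<close> only.\<close>

lemma reflection_product_displacement:
  "\<exists>m. \<mu> - reflection_product A xs \<mu> = A *v m \<and> (\<forall>j. j \<notin> set xs \<longrightarrow> m $ j = 0)"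
proof (induction xs)
  case Nil
  then show ?case by (intro exI[of _ 0]) (simp add: vec_eq_iff matrix_vector_mult_def)
next
  case (Cons x xs)
  then obtain m where m: "\<mu> - reflection_product A xs \<mu> = A *v m" "\<forall>j. j \<notin> set xs \<longrightarrow> m $ j = 0"
    by blast
  let ?\<nu> = "reflection_product A xs \<mu>"
  have "\<mu> - simple_reflection A x ?\<nu> = A *v (m + ?\<nu> $ x *s axis x 1)"
    using m(1) by (simp add: matrix_vector_mult_add matrix_vector_mult_scale mult_axis
        simple_reflection_def algebra_simps flip: m(1))
  moreover have "\<forall>j. j \<notin> set (x # xs) \<longrightarrow> (m + ?\<nu> $ x *s axis x 1) $ j = 0"
    using m(2) by (auto simp: axis_def)
  ultimately show ?case unfolding reflection_product_simps comp_apply by blast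
qed

lemma nonneg_add: "nonneg m \<Longrightarrow> nonneg n \<Longrightarrow> nonneg (m + n)"
  by (simp add: nonneg_def)

lemma nonneg_antisym: "nonneg m \<Longrightarrow> nonneg (- m) \<Longrightarrow> m = 0"
  by (metis neg_0_le_iff_le nonneg_def order_antisym uminus_vec_def vec_eq_iff vector_uminus_component zero_index)

lemma nonneg_scale: "0 \<le> k \<Longrightarrow> nonneg m \<Longrightarrow> nonneg (k *s m)"
  by (simp add: nonneg_def)

lemma nonneg_sum: "(\<And>x. x \<in> B \<Longrightarrow> nonneg (f x)) \<Longrightarrow> nonneg (sum f B)"
  by (simp add: nonneg_def sum_nonneg)


section \<open>Roots and the Weyl group\<close>

locale finite_type_cartan =
  fixes A :: "int^'n^'n" and d :: "'n \<Rightarrow> real"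
  assumes diag: "A $ i $ i = 2"
    and off_diag: "i \<noteq> j \<Longrightarrow> A $ i $ j \<le> 0"
    and d_pos: "d i > 0"
    and symmetrized: "d i * of_int (A $ i $ j) = d j * of_int (A $ j $ i)"
    and pos_def: "x \<noteq> 0 \<Longrightarrow>
      (\<Sum>i\<in>UNIV. \<Sum>j\<in>UNIV. d i * of_int (A $ i $ j) * x $ i * x $ j) > 0"
begin

text \<open>
  With coroots normalised so that \<open>(\<omega>\<^sub>i, \<alpha>\<^sub>j) = d\<^sub>j \<delta>\<^sub>i\<^sub>j\<close>, this is the invariant form between a weight
  and a vector given in the basis of simple roots; \<open>A *v m\<close> is the weight with root coordinates \<open>m\<close>.
\<close>

definition pairing :: "int^'n \<Rightarrow> int^'n \<Rightarrow> real" where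
  "pairing \<mu> m = (\<Sum>j\<in>UNIV. d j * of_int (\<mu> $ j) * of_int (m $ j))"

definition norm_sq :: "int^'n \<Rightarrow> real" where
  "norm_sq m = pairing (A *v m) m"

lemma pairing_diff_left: "pairing (\<mu> - \<nu>) m = pairing \<mu> m - pairing \<nu> m"
  by (simp add: pairing_def sum_subtractf algebra_simps)

lemma pairing_diff_right: "pairing \<mu> (m - n) = pairing \<mu> m - pairing \<mu> n"
  by (simp add: pairing_def sum_subtractf algebra_simps)

lemma pairing_uminus_left: "pairing (- \<mu>) m = - pairing \<mu> m"
  by (simp add: pairing_def sum_negf)

lemma pairing_scale_left: "pairing (k *s \<mu>) m = of_int k * pairing \<mu> m"
  by (simp add: pairing_def sum_distrib_left algebra_simps)

lemma pairing_scale_right: "pairing \<mu> (k *s m) = of_int k * pairing \<mu> m"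
  by (simp add: pairing_def sum_distrib_left algebra_simps)

lemma pairing_axis: "pairing \<mu> (axis i 1) = d i * of_int (\<mu> $ i)"
proof -
  have "pairing \<mu> (axis i 1) = (\<Sum>j\<in>UNIV. if j = i then d i * of_int (\<mu> $ i) else 0)"
    unfolding pairing_def by (rule sum.cong) (auto simp: axis_def)
  then show ?thesis by simp
qed

lemma pairing_fundamental: "pairing (fundamental_weight i) m = d i * of_int (m $ i)"
proof -
  have "pairing (fundamental_weight i) m = (\<Sum>j\<in>UNIV. if j = i then d i * of_int (m $ i) else 0)"
    unfolding pairing_def by (rule sum.cong) (auto simp: fundamental_weight_nth)
  then show ?thesis by simp
qed

lemma pairing_simple_root: "pairing (simple_root A i) m = d i * of_int ((A *v m) $ i)"
proof -
  have "d j * of_int (A $ j $ i) * of_int (m $ j) = d i * of_int (A $ i $ j * m $ j)" for j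
    using symmetrized[of j i] by simp
  then show ?thesis
    by (simp add: pairing_def simple_root_nth matrix_vector_mult_def sum_distrib_left
        del: of_int_mult)
qed

lemma norm_sq_sum:
  "norm_sq m = (\<Sum>i\<in>UNIV. \<Sum>j\<in>UNIV. d i * of_int (A $ i $ j) * of_int (m $ i) * of_int (m $ j))"
  unfolding norm_sq_def pairing_def matrix_vector_mult_def
  by (intro sum.cong refl) (simp add: sum_distrib_left sum_distrib_right algebra_simps)

lemma pairing_sym: "pairing (A *v m) n = pairing (A *v n) m"
proof -
  have "pairing (A *v m) n = (\<Sum>i\<in>UNIV. \<Sum>j\<in>UNIV. d i * of_int (A $ i $ j) * of_int (m $ j) * of_int (n $ i))"
    for m n
    by (simp add: pairing_def matrix_vector_mult_def sum_distrib_left sum_distrib_right mult.assoc)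
  note * = this
  have "pairing (A *v m) n
      = (\<Sum>j\<in>UNIV. \<Sum>i\<in>UNIV. d i * of_int (A $ i $ j) * of_int (m $ j) * of_int (n $ i))"
    unfolding * by (rule sum.swap)
  also have "\<dots> = pairing (A *v n) m"
    unfolding * using symmetrized by (intro sum.cong refl) (simp add: algebra_simps)
  finally show ?thesis .
qed

lemma norm_sq_pos: "m \<noteq> 0 \<Longrightarrow> norm_sq m > 0"
  using pos_def[of "\<chi> j. of_int (m $ j)"] by (simp add: norm_sq_sum vec_eq_iff)

text \<open>Equal images would give \<open>m - n\<close> norm 0. Hence identities between weights in
  the root lattice can be read in root coordinates.\<close>

lemma mult_inj: "A *v m = A *v n \<Longrightarrow> m = n"
  using norm_sq_pos[of "m - n"] by (fastforce simp: norm_sq_def pairing_def matrix_vector_mult_minus)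

lemma norm_sq_axis: "norm_sq (axis i 1) = 2 * d i"
  by (simp add: norm_sq_def pairing_axis mult_axis_nth diag)

lemma norm_sq_scale: "norm_sq (k *s m) = (of_int k)\<^sup>2 * norm_sq m"
  by (simp add: norm_sq_def matrix_vector_mult_scale pairing_scale_left pairing_scale_right
      power2_eq_square)

lemma norm_sq_diff: "norm_sq (m - n) = norm_sq m + norm_sq n - 2 * pairing (A *v m) n"
  using pairing_sym[of n m]
  by (simp add: norm_sq_def matrix_vector_mult_minus pairing_diff_left pairing_diff_right)

lemma pairing_reflection: "pairing (simple_reflection A i \<mu>) (root_reflection A i m) = pairing \<mu> m"
  by (simp add: simple_reflection_def root_reflection_def pairing_diff_left pairing_diff_right
      pairing_scale_left pairing_scale_right pairing_axis pairing_simple_root simple_root_nth diag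
      algebra_simps)

lemma pairing_product: "pairing (reflection_product A xs \<mu>) (root_product A xs m) = pairing \<mu> m"
  by (induction xs) (simp_all add: pairing_reflection)

lemma norm_sq_product: "norm_sq (root_product A xs m) = norm_sq m"
  by (simp add: norm_sq_def pairing_product flip: reflection_product_mult)

lemma simple_reflection_involutive: "simple_reflection A i (simple_reflection A i \<mu>) = \<mu>"
  by (rule simple_reflection_involution) (rule diag)

lemma root_reflection_involutive: "root_reflection A i (root_reflection A i m) = m"
  by (rule mult_inj) (simp add: simple_reflection_involutive flip: simple_reflection_mult)

lemma reflection_product_rev: "reflection_product A (rev xs) (reflection_product A xs \<mu>) = \<mu>"
  by (induction xs arbitrary: \<mu>) (simp_all add: simple_reflection_involutive)

lemma reflection_product_rev': "reflection_product A xs (reflection_product A (rev xs) \<mu>) = \<mu>"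
  using reflection_product_rev[of "rev xs"] by simp

lemma root_product_rev: "root_product A (rev xs) (root_product A xs m) = m"
  by (rule mult_inj) (simp add: reflection_product_rev flip: reflection_product_mult)

lemma root_product_rev': "root_product A xs (root_product A (rev xs) m) = m"
  using root_product_rev[of "rev xs"] by simp

lemma root_product_eq_if: "reflection_product A xs = reflection_product A ys \<Longrightarrow> root_product A xs = root_product A ys"
  by (rule ext, rule mult_inj) (simp flip: reflection_product_mult)

text \<open>
  The integrality condition says that \<open>2 m / (m, m)\<close> lies in the coroot lattice.  Every
  element of the Weyl orbit of a simple root satisfies it, and it is what forces coefficients of
  one sign.
\<close>

definition roots :: "(int^'n) set" where
  "roots = {m. \<exists>l. norm_sq m = 2 * d l \<and> (\<forall>a. \<exists>n::int. d a * of_int (m $ a) = of_int n * d l)}"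

section \<open>Invariance, sign and finiteness of roots\<close>

lemma axis_in_roots: "axis i 1 \<in> roots"
  unfolding roots_def
proof (intro CollectI exI[of _ i] conjI allI)
  fix a
  show "\<exists>n::int. d a * of_int (axis i 1 $ a) = of_int n * d i"
    by (intro exI[of _ "if a = i then 1 else 0"]) (auto simp: axis_def)
qed (rule norm_sq_axis)

lemma uminus_in_roots: "m \<in> roots \<Longrightarrow> - m \<in> roots"
proof -
  assume "m \<in> roots"
  then obtain l where l: "norm_sq m = 2 * d l" "\<And>a. \<exists>n::int. d a * of_int (m $ a) = of_int n * d l"
    unfolding roots_def by auto
  have "\<exists>n::int. d a * of_int ((- m) $ a) = of_int n * d l" for a
  proof -
    obtain n :: int where "d a * of_int (m $ a) = of_int n * d l" using l(2) by blast
    then show ?thesis by (intro exI[of _ "- n"]) simp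
  qed
  moreover have "norm_sq (- m) = 2 * d l"
    using l(1) norm_sq_scale[of "-1" m] by (simp add: vector_sneg_minus1)
  ultimately show ?thesis unfolding roots_def by blast
qed

lemma root_reflection_in_roots:
  assumes "m \<in> roots"
  shows "root_reflection A i m \<in> roots"
proof -
  from assms obtain l n where l: "norm_sq m = 2 * d l"
    and n: "\<And>a. d a * of_int (m $ a) = of_int (n a :: int) * d l"
    unfolding roots_def by auto metis
  \<comment> \<open>Symmetry moves the factor \<open>d i\<close> over to \<open>d b\<close>, so the
    integrality of the coefficients of \<open>m\<close> passes to this pairing.\<close>
  have "d i * of_int ((A *v m) $ i) = of_int (\<Sum>b\<in>UNIV. A $ b $ i * n b) * d l"
  proof -
    have "d i * of_int (A $ i $ b * m $ b) = of_int (A $ b $ i) * (d b * of_int (m $ b))" for b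
      using symmetrized[of i b] by simp
    then show ?thesis
      by (simp add: n matrix_vector_mult_def sum_distrib_left sum_distrib_right mult.assoc
          del: of_int_mult) (simp add: mult.assoc)
  qed
  then have "d i * of_int (m $ i - (A *v m) $ i)
      = of_int (n i - (\<Sum>b\<in>UNIV. A $ b $ i * n b)) * d l"
    using n[of i] by (simp add: algebra_simps)
  then have "\<exists>k::int. d a * of_int (root_reflection A i m $ a) = of_int k * d l" for a
    using n[of a] by (cases "a = i") (auto simp: root_reflection_nth simp del: of_int_diff)
  moreover have "norm_sq (root_reflection A i m) = 2 * d l"
    using norm_sq_product[of "[i]" m] l by simp
  ultimately show ?thesis unfolding roots_def by blast
qed

lemma root_product_in_roots: "m \<in> roots \<Longrightarrow> root_product A xs m \<in> roots"
  by (induction xs) (simp_all add: root_reflection_in_roots)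

lemma root_nonzero: "m \<in> roots \<Longrightarrow> m \<noteq> 0"
  using d_pos by (auto simp: roots_def norm_sq_def pairing_def less_le)

text \<open>Divided by \<open>d l\<close>, the norm is the sum of the integers
  \<open>n i * A $ i $ j * m $ j\<close>, which form a symmetric array with even diagonal.\<close>

lemma norm_sq_multiple:
  assumes "\<And>a. d a * of_int (m $ a) = of_int (n a :: int) * d l"
  shows "\<exists>k::int. norm_sq m = 2 * of_int k * d l"
proof -
  define S where "S i j = n i * A $ i $ j * m $ j" for i j
  have S: "of_int (S i j) * d l = d i * of_int (A $ i $ j) * of_int (m $ i) * of_int (m $ j)" for i j
    using assms[of i] by (simp add: S_def algebra_simps)
  have "S i j = S j i" for i j
  proof -
    have "of_int (S i j) * d l = of_int (S j i) * d l"
      unfolding S using symmetrized[of i j] by (simp add: algebra_simps)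
    then show ?thesis using d_pos[of l] by simp
  qed
  then have "even (\<Sum>i\<in>UNIV. \<Sum>j\<in>UNIV. S i j)"
    by (intro even_sum_symmetric) (simp_all add: S_def diag)
  then obtain k where "(\<Sum>i\<in>UNIV. \<Sum>j\<in>UNIV. S i j) = 2 * k" by blast
  then have "of_int (\<Sum>i\<in>UNIV. \<Sum>j\<in>UNIV. S i j) * d l = 2 * of_int k * d l" by simp
  then have "norm_sq m = 2 * of_int k * d l"
    by (simp add: norm_sq_sum S sum_distrib_right)
  then show ?thesis by blast
qed

text \<open>
  Split a root as \<open>p - q\<close> with \<open>p, q \<ge> 0\<close> of disjoint support.  Both parts inherit the
  integrality condition, so a nonzero part already has the norm \<open>2 d\<^sub>l\<close> of the root, whereas
  \<open>(p, q) \<le> 0\<close>.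
\<close>

lemma root_sign:
  assumes "m \<in> roots"
  shows "nonneg m \<or> nonneg (- m)"
proof -
  from assms obtain l n where l: "norm_sq m = 2 * d l"
    and n: "\<And>a. d a * of_int (m $ a) = of_int (n a :: int) * d l"
    unfolding roots_def by auto metis
  define p :: "int^'n" where "p = (\<chi> a. if m $ a \<ge> 0 then m $ a else 0)"
  define q :: "int^'n" where "q = (\<chi> a. if m $ a \<ge> 0 then 0 else - m $ a)"
  have m: "m = p - q" by (simp add: p_def q_def vec_eq_iff)
  have "d a * of_int (p $ a) = of_int (if m $ a \<ge> 0 then n a else 0) * d l"
    "d a * of_int (q $ a) = of_int (if m $ a \<ge> 0 then 0 else - n a) * d l" for a
    using n[of a] by (auto simp: p_def q_def)
  from norm_sq_multiple[OF this(1)] norm_sq_multiple[OF this(2)]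
  obtain k k' :: int where k: "norm_sq p = 2 * of_int k * d l" "norm_sq q = 2 * of_int k' * d l"
    by blast
  have big: "norm_sq r \<ge> 2 * d l" if "r \<noteq> 0" "norm_sq r = 2 * of_int j * d l" for r and j :: int
  proof -
    have "of_int j * d l > 0" using norm_sq_pos[OF that(1)] that(2) by simp
    then have "j > 0" using d_pos[of l] by (simp add: zero_less_mult_iff)
    then have "1 * d l \<le> of_int j * d l" using d_pos[of l] by (intro mult_right_mono) auto
    then show ?thesis using that(2) by simp
  qed
  have "pairing (A *v p) q \<le> 0"
  proof -
    have "A $ i $ j * p $ j * q $ i \<le> 0" for i j
    proof (cases "i = j")
      case True
      then show ?thesis by (simp add: p_def q_def)
    next
      case False
      have "0 \<le> p $ j" "0 \<le> q $ i" by (simp_all add: p_def q_def)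
      then show ?thesis
        using off_diag[OF False] by (simp add: mult_nonpos_nonneg mult.assoc)
    qed
    then have "(A *v p) $ i * q $ i \<le> 0" for i
      by (simp add: matrix_vector_mult_def sum_distrib_right sum_nonpos)
    then have "d i * of_int ((A *v p) $ i * q $ i) \<le> 0" for i
      using d_pos[of i] by (simp only: mult_le_0_iff of_int_le_0_iff) simp
    then show ?thesis unfolding pairing_def by (intro sum_nonpos) (simp add: mult.assoc)
  qed
  then have "norm_sq p + norm_sq q \<le> 2 * d l"
    using l unfolding m norm_sq_diff by simp
  then have "p = 0 \<or> q = 0"
    using big[OF _ k(1)] big[OF _ k(2)] d_pos[of l] by linarith
  moreover have "nonneg p" "nonneg q" by (simp_all add: nonneg_def p_def q_def)
  ultimately show ?thesis by (auto simp: m)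
qed

text \<open>For \<open>m = k *s axis i 1\<close> the norm gives
  \<open>k\<^sup>2 d\<^sub>i = d\<^sub>l\<close>, and integrality gives
  \<open>k d\<^sub>i = n d\<^sub>l\<close>; so \<open>k n = 1\<close>.\<close>

lemma root_multiple_of_axis:
  assumes "m \<in> roots" "nonneg m" "\<And>j. j \<noteq> i \<Longrightarrow> m $ j = 0"
  shows "m = axis i 1"
proof -
  from assms obtain l n where l: "norm_sq m = 2 * d l"
    and n: "\<And>a. d a * of_int (m $ a) = of_int (n a :: int) * d l"
    unfolding roots_def by auto metis
  have m: "m = m $ i *s axis i 1" using assms(3) by (auto simp: vec_eq_iff axis_def)
  have "norm_sq m = (of_int (m $ i))\<^sup>2 * (2 * d i)"
    using arg_cong[OF m, of norm_sq] by (simp only: norm_sq_scale norm_sq_axis)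
  then have "(of_int (m $ i))\<^sup>2 * d i = d l" using l by simp
  then have "of_int (m $ i) * (d i * of_int (m $ i)) = d l"
    by (simp add: power2_eq_square mult_ac)
  then have "of_int (m $ i) * of_int (n i) * d l = d l"
    unfolding n by (simp only: mult.assoc)
  then have "of_int (m $ i * n i) = (1 :: real)" using d_pos[of l] by simp
  then have "m $ i * n i = 1" by linarith
  moreover have "m $ i \<ge> 0" using assms(2) by (simp add: nonneg_def)
  ultimately have "m $ i = 1" by (simp add: zmult_eq_1_iff)
  with m show ?thesis by (simp only: vector_smult_lid)
qed

text \<open>The reflection changes only coefficient \<open>i\<close>. If the result were negative,
  all other coefficients of \<open>m\<close> would vanish.\<close>

lemma root_reflection_nonneg:
  assumes "m \<in> roots" "nonneg m" "m \<noteq> axis i 1"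
  shows "nonneg (root_reflection A i m)"
proof (rule ccontr)
  assume "\<not> nonneg (root_reflection A i m)"
  then have *: "nonneg (- root_reflection A i m)"
    using root_sign root_reflection_in_roots assms by blast
  have "m $ j = 0" if "j \<noteq> i" for j
  proof -
    have "- (m $ j) \<ge> 0" using * that by (auto simp: nonneg_def root_reflection_nth dest: spec[of _ j])
    then show ?thesis using assms(2) by (simp add: nonneg_def order_antisym)
  qed
  then show False using root_multiple_of_axis assms by blast
qed

text \<open>By compactness of the unit sphere the form dominates a positive multiple of the
  Euclidean norm squared, and the roots have bounded norm.\<close>

lemma finite_roots: "finite roots"
proof -
  define f :: "real^'n \<Rightarrow> real" where
    "f x = (\<Sum>i\<in>UNIV. \<Sum>j\<in>UNIV. d i * of_int (A $ i $ j) * x $ i * x $ j)" for x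
  have "continuous_on (sphere 0 1) f"
    unfolding f_def by (intro continuous_intros)
  moreover have "sphere (0 :: real^'n) 1 \<noteq> {}" by simp
  ultimately obtain u where u: "u \<in> sphere 0 1" "\<And>x. x \<in> sphere 0 1 \<Longrightarrow> f u \<le> f x"
    using continuous_attains_inf[of "sphere 0 1" f] by auto
  have "u \<noteq> 0" using u(1) by auto
  then have pos: "f u > 0" unfolding f_def by (rule pos_def)
  have lower: "f u * (norm x)\<^sup>2 \<le> f x" for x
  proof (cases "x = 0")
    case False
    have "f ((1 / norm x) *\<^sub>R x) = (1 / norm x)\<^sup>2 * f x"
      by (simp add: f_def sum_distrib_left power2_eq_square algebra_simps)
    moreover have "f u \<le> f ((1 / norm x) *\<^sub>R x)" using False by (intro u(2)) simp
    ultimately have "f u \<le> f x / (norm x)\<^sup>2" by (simp add: power_one_over)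
    then show ?thesis using False by (simp add: pos_le_divide_eq)
  qed (simp add: f_def)
  \<comment> \<open>The sum serves as a common bound for the positive numbers
    \<open>2 * d l\<close>.\<close>
  define C where "C = (\<Sum>l\<in>UNIV. 2 * d l)"
  have C: "2 * d l \<le> C" for l
    unfolding C_def using d_pos by (intro member_le_sum) (auto intro: less_imp_le)
  have "\<bar>m $ j\<bar> \<le> \<lceil>C / f u\<rceil>" if m: "m \<in> roots" for m j
  proof -
    define x :: "real^'n" where "x = (\<chi> j. of_int (m $ j))"
    obtain l where "norm_sq m = 2 * d l" using m unfolding roots_def by blast
    then have "f x \<le> C" using C[of l] by (simp add: f_def x_def norm_sq_sum)
    then have "(norm x)\<^sup>2 \<le> C / f u" using lower[of x] pos by (simp add: field_simps)
    moreover have "\<bar>x $ j\<bar> \<le> norm x" by (rule component_le_norm_cart)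
    then have "\<bar>x $ j\<bar>\<^sup>2 \<le> (norm x)\<^sup>2" by (intro power_mono) auto
    \<comment> \<open>An integer is at most its square in absolute value, so the bound on the square
      already bounds the coordinate.\<close>
    moreover have "of_int \<bar>m $ j\<bar> \<le> (of_int \<bar>m $ j\<bar> :: real)\<^sup>2"
    proof (cases "m $ j = 0")
      case False
      then have "1 \<le> \<bar>m $ j\<bar>" by simp
      then have "\<bar>m $ j\<bar> * 1 \<le> \<bar>m $ j\<bar> * \<bar>m $ j\<bar>" by (intro mult_left_mono) auto
      then show ?thesis unfolding power2_eq_square of_int_mult[symmetric] of_int_le_iff by simp
    qed simp
    ultimately have "of_int \<bar>m $ j\<bar> \<le> C / f u" by (simp add: x_def)
    then show ?thesis by linarith
  qed
  then have "roots \<subseteq> {m. \<forall>j. \<bar>m $ j\<bar> \<le> \<lceil>C / f u\<rceil>}" by blast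
  then show ?thesis using finite_bounded_int_vec finite_subset by blast
qed


section \<open>The exchange property\<close>

lemma root_reflection_axis: "root_reflection A i (axis i 1) = - axis i 1"
  by (simp add: root_reflection_def mult_axis_nth diag vec_eq_iff)

lemma axis_not_nonpos: "\<not> nonneg (- axis i 1 :: int^'n)"
  by (auto simp: nonneg_def axis_def dest: spec[of _ i])

lemma reflection_conjugate:
  assumes "root_product A xs (axis i 1) = axis x 1"
  shows "reflection_product A xs (simple_reflection A i \<mu>)
    = simple_reflection A x (reflection_product A xs \<mu>)"
proof -
  have "d x = d i"
    using norm_sq_product[of xs "axis i 1"] by (simp add: assms norm_sq_axis)
  moreover have "d x * of_int (reflection_product A xs \<mu> $ x) = d i * of_int (\<mu> $ i)"
    using pairing_product[of xs \<mu> "axis i 1"] by (simp add: assms pairing_axis)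
  ultimately have "reflection_product A xs \<mu> $ x = \<mu> $ i"
    using d_pos[of i] by simp
  moreover have "reflection_product A xs (simple_root A i) = simple_root A x"
    using reflection_product_mult[of A xs "axis i 1"] by (simp add: assms mult_axis)
  ultimately show ?thesis
    by (simp add: simple_reflection_def reflection_product_diff reflection_product_scale)
qed

text \<open>Apply the letters of \<open>xs\<close> to the simple root from right to left. The first
  letter \<open>x\<close> that makes it negative meets it as the simple root of \<open>x\<close>;
  conjugation then moves the final \<open>i\<close> to the place of \<open>x\<close>, where the two
  cancel.\<close>

lemma exchange:
  assumes "nonneg (- root_product A xs (axis i 1))"
  shows "\<exists>ys. length ys < length xs \<and> reflection_product A (xs @ [i]) = reflection_product A ys"
  using assms
proof (induction xs)
  case Nil
  then show ?case by (simp add: axis_not_nonpos)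
next
  case (Cons x xs)
  let ?\<gamma> = "root_product A xs (axis i 1)"
  have root: "?\<gamma> \<in> roots" by (intro root_product_in_roots axis_in_roots)
  show ?case
  proof (cases "nonneg (- ?\<gamma>)")
    case True
    then obtain ys where "length ys < length xs"
      "reflection_product A (xs @ [i]) = reflection_product A ys"
      using Cons.IH by blast
    then show ?thesis
      by (intro exI[of _ "x # ys"]) simp
  next
    case False
    then have "nonneg ?\<gamma>" using root_sign root by blast
    moreover have "root_reflection A x ?\<gamma> \<noteq> 0"
      by (intro root_nonzero root_reflection_in_roots root)
    then have "\<not> nonneg (root_reflection A x ?\<gamma>)"
      using Cons.prems nonneg_antisym by auto
    ultimately have "?\<gamma> = axis x 1" using root_reflection_nonneg root by blast
    then have "reflection_product A (x # xs @ [i]) = reflection_product A xs"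
      by (simp add: fun_eq_iff reflection_conjugate simple_reflection_involutive)
    then show ?thesis by (intro exI[of _ xs]) simp
  qed
qed

text \<open>In a nonempty word the letters before the last one send its simple root to a negative
  root, so \<open>exchange\<close> yields a shorter word for the same element.\<close>

lemma reflection_product_eq_id:
  assumes "\<And>i. nonneg (root_product A xs (axis i 1))"
  shows "reflection_product A xs = id"
  using assms
proof (induction xs rule: length_induct)
  case (1 xs)
  show ?case
  proof (cases xs rule: rev_cases)
    case (snoc zs k)
    have "nonneg (- root_product A zs (axis k 1))"
      using 1(2)[of k] by (simp add: snoc root_reflection_axis root_product_minus)
    then obtain ys where ys: "length ys < length zs" "reflection_product A xs = reflection_product A ys"
      using exchange snoc by blast
    have "root_product A xs = root_product A ys" by (rule root_product_eq_if) (rule ys)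
    then have "reflection_product A ys = id"
      using 1 ys(1) snoc by (intro 1(1)[rule_format]) auto
    then show ?thesis using ys by simp
  qed simp
qed

lemma reflection_product_eqI:
  assumes "\<And>i. nonneg (root_product A (rev xs) (root_product A ys (axis i 1)))"
  shows "reflection_product A xs = reflection_product A ys"
proof -
  have "reflection_product A (rev xs @ ys) = id"
    by (rule reflection_product_eq_id) (simp add: assms)
  then have "reflection_product A (rev xs) (reflection_product A ys \<mu>) = \<mu>" for \<mu>
    by (simp add: fun_eq_iff)
  then show ?thesis by (metis ext reflection_product_rev')
qed

text \<open>
  Along a word \<open>xs = ys @ [l]\<close> that cannot be shortened, the displacement of \<open>\<omega>\<^sub>l\<close> grows by the
  positive root \<open>ys(\<alpha>\<^sub>l)\<close>.
\<close>

lemma fundamental_displacement: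
  "\<exists>m. nonneg m \<and> fundamental_weight l - reflection_product A xs (fundamental_weight l) = A *v m
    \<and> (m $ l = 0 \<longrightarrow> m = 0)"
proof (induction xs rule: length_induct)
  case (1 xs)
  let ?\<omega> = "fundamental_weight l :: int^'n"
  show ?case
  proof (cases xs rule: rev_cases)
    case Nil
    then show ?thesis by (intro exI[of _ 0]) (simp add: matrix_vector_mult_zero nonneg_def)
  next
    case (snoc ys i)
    have root: "root_product A ys (axis i 1) \<in> roots" by (intro root_product_in_roots axis_in_roots)
    consider "nonneg (- root_product A ys (axis i 1))" | "nonneg (root_product A ys (axis i 1))" "i \<noteq> l"
      | "nonneg (root_product A ys (axis i 1))" "i = l"
      using root_sign[OF root] by blast
    then show ?thesis
    proof cases
      case 1
      then obtain zs where "length zs < length ys"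
        "reflection_product A (ys @ [i]) = reflection_product A zs"
        using exchange by blast
      then show ?thesis using "1.IH" snoc by simp
    next
      case 2
      then have "reflection_product A xs ?\<omega> = reflection_product A ys ?\<omega>"
        using reflection_product_fundamental_other[of l "[i]" A] by (simp add: snoc)
      then show ?thesis using "1.IH" snoc by simp
    next
      case 3
      let ?\<gamma> = "root_product A ys (axis l 1)"
      obtain m where m: "nonneg m" "?\<omega> - reflection_product A ys ?\<omega> = A *v m" "m $ l = 0 \<longrightarrow> m = 0"
        using "1.IH" snoc by auto
      have "?\<omega> - reflection_product A xs ?\<omega> = A *v (m + ?\<gamma>)"
        using 3 m(2)
        by (simp add: snoc simple_reflection_fundamental reflection_product_diff
            reflection_product_mult matrix_vector_mult_add algebra_simps)
      moreover have "nonneg (m + ?\<gamma>)" using 3 m(1) by (simp add: nonneg_add)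
      \<comment> \<open>If the coefficient vanished, then \<open>m = 0\<close> and \<open>ys\<close>
        would fix the fundamental weight; invariance of the pairing would then force
        \<open>?\<gamma> $ l = 1\<close>.\<close>
      moreover have "(m + ?\<gamma>) $ l \<noteq> 0"
      proof
        assume *: "(m + ?\<gamma>) $ l = 0"
        have "m $ l \<ge> 0" "?\<gamma> $ l \<ge> 0" using m(1) 3 by (auto simp: nonneg_def)
        with * have "m $ l = 0" and \<gamma>: "?\<gamma> $ l = 0" by auto
        then have "m = 0" using m(3) by blast
        then have "reflection_product A ys ?\<omega> = ?\<omega>"
          using m(2) by (simp add: matrix_vector_mult_zero)
        then have "pairing ?\<omega> ?\<gamma> = pairing ?\<omega> (axis l 1)"
          using pairing_product[of ys ?\<omega> "axis l 1"] by simp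
        then show False using d_pos[of l] \<gamma> by (simp add: pairing_fundamental axis_def)
      qed
      ultimately show ?thesis by blast
    qed
  qed
qed

section \<open>Dominant weights in a Weyl orbit\<close>

lemma dominant_displacement:
  assumes "nonneg \<mu>"
  shows "\<exists>m. nonneg m \<and> \<mu> - reflection_product A xs \<mu> = A *v m"
proof -
  obtain f where f: "\<And>l. nonneg (f l)"
    "\<And>l. fundamental_weight l - reflection_product A xs (fundamental_weight l) = A *v f l"
    using fundamental_displacement[of _ xs] by metis
  let ?m = "\<Sum>l\<in>UNIV. \<mu> $ l *s f l"
  have "A *v ?m = (\<Sum>l\<in>UNIV. \<mu> $ l *s fundamental_weight l
      - reflection_product A xs (\<mu> $ l *s fundamental_weight l))"
    by (simp add: matrix_vector_mult_sum matrix_vector_mult_scale reflection_product_scale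
        vector_ssub_ldistrib flip: f(2))
  also have "\<dots> = \<mu> - reflection_product A xs \<mu>"
    by (simp add: sum_subtractf flip: reflection_product_sum weight_expansion)
  finally have "\<mu> - reflection_product A xs \<mu> = A *v ?m" ..
  moreover have "nonneg ?m"
    using assms f(1) by (intro nonneg_sum nonneg_scale) (auto simp: nonneg_def)
  ultimately show ?thesis by blast
qed

text \<open>Each of the two weights exceeds the other by a nonnegative combination of simple roots,
  so both combinations vanish.\<close>

lemma dominant_in_orbit_unique:
  assumes "nonneg \<mu>" "nonneg (reflection_product A xs \<mu>)"
  shows "reflection_product A xs \<mu> = \<mu>"
proof -
  obtain m where m: "nonneg m" "\<mu> - reflection_product A xs \<mu> = A *v m"
    using dominant_displacement assms(1) by blast
  obtain n where n: "nonneg n" "reflection_product A xs \<mu> - \<mu> = A *v n"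
    using dominant_displacement[OF assms(2), of "rev xs"] by (auto simp: reflection_product_rev)
  have "A *v n = A *v (- m)"
    by (simp add: matrix_vector_mult_uminus flip: m(2) n(2))
  then have "n = - m" by (rule mult_inj)
  then have "m = 0" using m n nonneg_antisym by blast
  then show ?thesis using m(2) by (simp add: matrix_vector_mult_zero)
qed

lemma nonneg_fundamental: "nonneg (fundamental_weight i)"
  by (simp add: nonneg_def fundamental_weight_nth)

section \<open>The Weyl group as a finite group of words\<close>

text \<open>An element is determined by the images of the simple roots, which lie in the finite set
  \<open>roots\<close>.\<close>

lemma finite_reflection_products: "finite (range (reflection_product A))"
proof -
  define F where "F xs = (\<lambda>i. root_product A xs (axis i 1))" for xs
  have "F xs \<in> PiE UNIV (\<lambda>_. roots)" for xs
    by (auto simp: F_def intro: root_product_in_roots axis_in_roots)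
  then have "range F \<subseteq> PiE UNIV (\<lambda>_. roots)" by blast
  then have "finite (range F)"
    by (rule finite_subset) (intro finite_PiE finite_roots; simp)
  have eq: "reflection_product A xs = reflection_product A ys" if "F xs = F ys" for xs ys
  proof (rule reflection_product_eqI)
    fix i
    have "root_product A ys (axis i 1) = root_product A xs (axis i 1)"
      using that by (simp add: F_def fun_eq_iff)
    then show "nonneg (root_product A (rev xs) (root_product A ys (axis i 1)))"
      by (simp add: root_product_rev nonneg_def axis_def)
  qed
  have "range (reflection_product A) \<subseteq> (\<lambda>f. reflection_product A (SOME xs. F xs = f)) ` range F"
  proof
    fix w assume "w \<in> range (reflection_product A)"
    then obtain xs where xs: "w = reflection_product A xs" by blast
    have "F (SOME ys. F ys = F xs) = F xs" by (rule someI) simp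
    then have "w = reflection_product A (SOME ys. F ys = F xs)" using eq xs by metis
    then show "w \<in> (\<lambda>f. reflection_product A (SOME xs. F xs = f)) ` range F" by blast
  qed
  with \<open>finite (range F)\<close> show ?thesis by (meson finite_imageI finite_subset)
qed

lemma reflection_product_in_Bij: "reflection_product A xs \<in> carrier (BijGroup UNIV)"
  using reflection_product_rev[of xs] reflection_product_rev'[of xs]
  by (auto simp: BijGroup_def Bij_def intro!: o_bij[of "reflection_product A (rev xs)"])

lemma weyl_mult:
  "reflection_product A xs \<otimes>\<^bsub>weyl_group A J\<^esub> reflection_product A ys
    = reflection_product A xs \<circ> reflection_product A ys"
  using reflection_product_in_Bij[of xs] reflection_product_in_Bij[of ys]
  by (simp add: weyl_group_def BijGroup_def compose_def fun_eq_iff)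

lemma weyl_one: "\<one>\<^bsub>weyl_group A J\<^esub> = id"
  by (simp add: weyl_group_def BijGroup_def fun_eq_iff)

lemma group_weyl: "group (weyl_group A J)"
  unfolding weyl_group_def by (intro group.group_subgroup_generated group_BijGroup)

text \<open>The generators are involutions, so inverses contribute no new elements and words
  suffice.\<close>

lemma carrier_weyl_group: "carrier (weyl_group A J) = {reflection_product A xs |xs. set xs \<subseteq> J}"
proof
  interpret B: group "BijGroup (UNIV :: (int^'n) set)" by (rule group_BijGroup)
  have gens: "simple_reflection A j = reflection_product A [j]" for j by simp
  have carrier: "carrier (weyl_group A J) = generate (BijGroup UNIV) (simple_reflection A ` J)"
    using reflection_product_in_Bij[of "[_]"]
    by (simp add: weyl_group_def carrier_subgroup_generated Int_absorb1 image_subset_iff)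
  have mult: "reflection_product A xs \<otimes>\<^bsub>BijGroup UNIV\<^esub> reflection_product A ys
    = reflection_product A (xs @ ys)" for xs ys
    using weyl_mult[of UNIV xs ys] by (simp add: weyl_group_def)
  have unit: "\<one>\<^bsub>BijGroup UNIV\<^esub> = reflection_product A []"
    using weyl_one[of UNIV] by (simp add: weyl_group_def)
  show "carrier (weyl_group A J) \<subseteq> {reflection_product A xs |xs. set xs \<subseteq> J}"
  proof
    fix w assume "w \<in> carrier (weyl_group A J)"
    then have "w \<in> generate (BijGroup UNIV) (simple_reflection A ` J)" by (simp add: carrier)
    then show "w \<in> {reflection_product A xs |xs. set xs \<subseteq> J}"
    proof induction
      case one
      show ?case unfolding unit by (auto intro!: exI[of _ "[]"])
    next
      case (incl h)
      then obtain j where "j \<in> J" "h = reflection_product A [j]" using gens by blast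
      then show ?case by (auto intro!: exI[of _ "[j]"])
    next
      case (inv h)
      then obtain j where j: "j \<in> J" "h = reflection_product A [j]" using gens by blast
      have "h \<otimes>\<^bsub>BijGroup UNIV\<^esub> h = \<one>\<^bsub>BijGroup UNIV\<^esub>"
        unfolding j(2) mult unit by (simp add: fun_eq_iff simple_reflection_involutive)
      then have "inv\<^bsub>BijGroup UNIV\<^esub> h = h"
        using reflection_product_in_Bij by (intro B.inv_equality) (simp_all add: j(2) del: reflection_product_simps)
      then show ?case using j by (auto intro!: exI[of _ "[j]"])
    next
      case (eng h1 h2)
      then obtain xs ys where "set (xs @ ys) \<subseteq> J" "h1 = reflection_product A xs" "h2 = reflection_product A ys"
        by auto
      then show ?case using mult by blast
    qed
  qed
  have "reflection_product A xs \<in> carrier (weyl_group A J)" if "set xs \<subseteq> J" for xs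
    using that
  proof (induction xs)
    case Nil
    show ?case unfolding carrier unit[symmetric] by (rule generate.one)
  next
    case (Cons x xs)
    then have "reflection_product A [x] \<otimes>\<^bsub>BijGroup UNIV\<^esub> reflection_product A xs
        \<in> carrier (weyl_group A J)"
      unfolding carrier by (intro generate.eng[OF generate.incl]) auto
    then show ?case by (simp add: mult del: reflection_product_simps)
  qed
  then show "{reflection_product A xs |xs. set xs \<subseteq> J} \<subseteq> carrier (weyl_group A J)" by blast
qed

section \<open>Length, longest element and star involution\<close>

lemma weyl_length_le: "weyl_length A (reflection_product A xs) \<le> length xs"
  unfolding weyl_length_def by (rule Least_le) blast

lemma weyl_length_attained:
  obtains ys where "length ys = weyl_length A (reflection_product A xs)"
    "reflection_product A ys = reflection_product A xs"
proof -
  have "\<exists>n ys. length ys = n \<and> reflection_product A ys = reflection_product A xs" by blast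
  from LeastI_ex[OF this] show ?thesis using that unfolding weyl_length_def by blast
qed

text \<open>An element of maximal length makes every simple root negative, since otherwise appending
  a letter would lengthen it. Two such elements coincide, which gives the \<open>THE\<close> in
  \<open>longest_element\<close> its value.\<close>

lemma longest_element_inverts:
  "\<exists>ys. longest_element A = reflection_product A ys \<and> (\<forall>i. nonneg (- root_product A ys (axis i 1)))"
proof -
  let ?W = "range (reflection_product A)"
  have W: "carrier (weyl_group A UNIV) = ?W" by (auto simp: carrier_weyl_group)
  \<comment> \<open>A shortest word \<open>zs\<close> for the longer product sends the simple root
    of \<open>i\<close> to a negative root; \<open>exchange\<close> gives a word for
    \<open>xs\<close> shorter than \<open>zs\<close>.\<close>
  have shorter: "weyl_length A (reflection_product A xs) < weyl_length A (reflection_product A (xs @ [i]))"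
    if "nonneg (root_product A xs (axis i 1))" for xs i
  proof -
    obtain zs where zs: "length zs = weyl_length A (reflection_product A (xs @ [i]))"
      "reflection_product A zs = reflection_product A (xs @ [i])"
      by (rule weyl_length_attained)
    have "root_product A zs = root_product A (xs @ [i])" by (rule root_product_eq_if) (rule zs)
    then have "nonneg (- root_product A zs (axis i 1))"
      using that by (simp add: root_reflection_axis root_product_minus)
    then obtain us where us: "length us < length zs"
      "reflection_product A (zs @ [i]) = reflection_product A us"
      using exchange by blast
    have "reflection_product A (zs @ [i]) = reflection_product A xs"
      using zs(2) by (simp add: fun_eq_iff simple_reflection_involutive)
    then show ?thesis using weyl_length_le[of us] us zs(1) by simp
  qed
  have inverts: "nonneg (- root_product A xs (axis i 1))"
    if "\<And>v. v \<in> ?W \<Longrightarrow> weyl_length A v \<le> weyl_length A (reflection_product A xs)" for xs i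
  proof (rule ccontr)
    assume "\<not> nonneg (- root_product A xs (axis i 1))"
    then have "nonneg (root_product A xs (axis i 1))"
      using root_sign root_product_in_roots axis_in_roots by blast
    then show False using shorter that[of "reflection_product A (xs @ [i])"] by (meson leD rangeI)
  qed
  have fin: "finite (weyl_length A ` ?W)"
    by (intro finite_imageI finite_reflection_products)
  then have "Max (weyl_length A ` ?W) \<in> weyl_length A ` ?W" by (rule Max_in) blast
  then obtain xs where "Max (weyl_length A ` ?W) = weyl_length A (reflection_product A xs)" by blast
  then have max: "weyl_length A v \<le> weyl_length A (reflection_product A xs)" if "v \<in> ?W" for v
    using Max_ge[OF fin imageI[OF that]] by simp
  have uniq: "v = reflection_product A xs"
    if v: "v \<in> ?W" "weyl_length A v = weyl_length A (reflection_product A xs)" for v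
  proof -
    obtain ys where ys: "v = reflection_product A ys" using v(1) by blast
    have neg: "nonneg (- root_product A xs (axis i 1))" "nonneg (- root_product A ys (axis i 1))" for i
      using inverts max v(2) ys by metis+
    \<comment> \<open>A negative value would be a nonpositive combination of simple roots;
      \<open>ys\<close> negates simple roots and would turn it into a positive root, but its image
      is the negative root \<open>root_product A xs (axis i 1)\<close>.\<close>
    have "nonneg (root_product A (rev ys) (root_product A xs (axis i 1)))" for i
    proof (rule ccontr)
      let ?m = "root_product A (rev ys) (root_product A xs (axis i 1))"
      assume "\<not> nonneg ?m"
      then have "nonneg (- ?m)"
        using root_sign root_product_in_roots axis_in_roots by blast
      then have "nonneg (\<Sum>j\<in>UNIV. (- ?m) $ j *s (- root_product A ys (axis j 1)))"
        using neg(2) by (intro nonneg_sum nonneg_scale) (auto simp: nonneg_def)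
      also have "(\<Sum>j\<in>UNIV. (- ?m) $ j *s (- root_product A ys (axis j 1))) = root_product A ys ?m"
        unfolding root_product_expansion[of A ys ?m]
        by (intro sum.cong refl) (simp add: vec_eq_iff)
      also have "\<dots> = root_product A xs (axis i 1)" by (rule root_product_rev')
      finally have "root_product A xs (axis i 1) = 0" using neg(1)[of i] nonneg_antisym by blast
      then show False using root_nonzero root_product_in_roots axis_in_roots by blast
    qed
    then show ?thesis using reflection_product_eqI ys by blast
  qed
  have "longest_element A = reflection_product A xs"
    unfolding longest_element_def W
  proof (rule the_equality)
    show "reflection_product A xs \<in> ?W \<and>
      (\<forall>v\<in>?W. v \<noteq> reflection_product A xs \<longrightarrow> weyl_length A v < weyl_length A (reflection_product A xs))"
      using max uniq by (meson le_neq_implies_less rangeI)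
  next
    fix w assume w: "w \<in> ?W \<and> (\<forall>v\<in>?W. v \<noteq> w \<longrightarrow> weyl_length A v < weyl_length A w)"
    show "w = reflection_product A xs"
    proof (rule ccontr)
      assume "w \<noteq> reflection_product A xs"
      then have "weyl_length A (reflection_product A xs) < weyl_length A w" using w by auto
      then show False using max[of w] w by simp
    qed
  qed
  then show ?thesis using inverts max by blast
qed

text \<open>The longest element and its inverse make simple roots negative, so it sends
  \<open>- fundamental_weight j\<close> to a dominant weight. That weight lies in the orbit of
  \<open>fundamental_weight i\<close> and therefore equals it.\<close>

lemma longest_element_fundamental:
  assumes "reflection_product A xs (fundamental_weight i) = - fundamental_weight j"
  shows "longest_element A (fundamental_weight j) = - fundamental_weight i"
proof -
  obtain ys where ys: "longest_element A = reflection_product A ys"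
    "\<And>i. nonneg (- root_product A ys (axis i 1))"
    using longest_element_inverts by blast
  have neg: "nonneg (- root_product A (rev ys) (axis k 1))" for k
  proof (rule ccontr)
    let ?m = "root_product A (rev ys) (axis k 1)"
    assume "\<not> nonneg (- ?m)"
    then have "nonneg ?m" using root_sign root_product_in_roots axis_in_roots by blast
    then have "nonneg (\<Sum>j\<in>UNIV. ?m $ j *s (- root_product A ys (axis j 1)))"
      using ys(2) by (intro nonneg_sum nonneg_scale) (auto simp: nonneg_def)
    also have "(\<Sum>j\<in>UNIV. ?m $ j *s (- root_product A ys (axis j 1))) = - root_product A ys ?m"
      unfolding root_product_expansion[of A ys ?m] sum_negf[symmetric]
      by (intro sum.cong refl) (simp add: vec_eq_iff)
    also have "\<dots> = - axis k 1" by (simp add: root_product_rev')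
    finally show False by (simp add: axis_not_nonpos)
  qed
  let ?v = "reflection_product A ys (- fundamental_weight j)"
  have "nonneg ?v"
    unfolding nonneg_def
  proof
    fix k
    have "d k * of_int (?v $ k) = pairing ?v (root_product A ys (root_product A (rev ys) (axis k 1)))"
      by (simp add: root_product_rev' pairing_axis)
    also have "\<dots> = d j * of_int ((- root_product A (rev ys) (axis k 1)) $ j)"
      by (simp add: pairing_product pairing_uminus_left pairing_fundamental)
    also have "\<dots> \<ge> 0" using neg[of k] d_pos[of j] by (intro mult_nonneg_nonneg) (auto simp: nonneg_def less_imp_le)
    finally show "0 \<le> ?v $ k" using d_pos[of k] by (simp add: zero_le_mult_iff)
  qed
  then have "nonneg (reflection_product A (ys @ xs) (fundamental_weight i))"
    by (simp add: assms)
  then have "?v = fundamental_weight i"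
    using dominant_in_orbit_unique[OF nonneg_fundamental] assms by fastforce
  then show ?thesis by (simp add: ys(1) reflection_product_minus minus_equation_iff)
qed

lemma fundamental_weight_eq_iff: "fundamental_weight i = (fundamental_weight j :: int^'n) \<longleftrightarrow> i = j"
  by (auto simp: fundamental_weight_def axis_eq_axis)

text \<open>This reads \<open>star\<close> off any word, in particular off a power of a Coxeter
  element. The reversed word gives the first equation.\<close>

lemma star_eqI:
  assumes "reflection_product A xs (fundamental_weight i) = - fundamental_weight j"
  shows "star A i = j" "star A j = i"
proof -
  have star: "star A k = l" if "reflection_product A ys (fundamental_weight l) = - fundamental_weight k" for ys k l
    using longest_element_fundamental[OF that]
    by (auto simp: star_def fundamental_weight_eq_iff intro: the_equality)
  have "reflection_product A (rev xs) (- fundamental_weight j) = fundamental_weight i"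
    by (simp add: reflection_product_rev flip: assms)
  then have "reflection_product A (rev xs) (fundamental_weight j) = - fundamental_weight i"
    by (simp add: reflection_product_minus minus_equation_iff)
  then show "star A i = j" "star A j = i" using star assms by blast+
qed


section \<open>Inversions and fixed vectors of a word\<close>

text \<open>Apply the letters of \<open>xs\<close> to \<open>\<gamma>\<close> from left to right.
  Just before it first turns negative it is the simple root of the next letter \<open>t\<close>;
  undoing the letters before \<open>t\<close> recovers \<open>\<gamma>\<close>.\<close>

lemma inverted_root:
  assumes "\<gamma> \<in> roots" "nonneg \<gamma>" "\<not> nonneg (root_product A (rev xs) \<gamma>)"
  shows "\<exists>us t vs. xs = us @ t # vs \<and> \<gamma> = root_product A us (axis t 1)"
  using assms
proof (induction xs arbitrary: \<gamma>)
  case (Cons x xs)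
  show ?case
  proof (cases "\<gamma> = axis x 1")
    case True
    then have "x # xs = [] @ x # xs" "\<gamma> = root_product A [] (axis x 1)" by simp_all
    then show ?thesis by blast
  next
    case False
    then have "nonneg (root_reflection A x \<gamma>)"
      using Cons.prems by (intro root_reflection_nonneg) auto
    moreover have "\<not> nonneg (root_product A (rev xs) (root_reflection A x \<gamma>))"
      using Cons.prems(3) by simp
    ultimately obtain us t vs where "xs = us @ t # vs" "root_reflection A x \<gamma> = root_product A us (axis t 1)"
      using Cons.IH root_reflection_in_roots[OF Cons.prems(1)] by blast
    then have "x # xs = (x # us) @ t # vs" "\<gamma> = root_product A (x # us) (axis t 1)"
      using root_reflection_involutive[of x \<gamma>] by simp_all
    then show ?thesis by blast
  qed
qed simp

text \<open>Move the first letter \<open>x\<close> to the other side: the displacement of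
  \<open>v\<close> is then both a multiple of the simple root of \<open>x\<close> and a combination
  of the simple roots of the later letters. Independence makes it zero.\<close>

lemma fixed_by_distinct_product:
  assumes "distinct xs" "reflection_product A xs v = v" "j \<in> set xs"
  shows "v $ j = 0"
  using assms
proof (induction xs)
  case (Cons x xs)
  obtain m where m: "v - reflection_product A xs v = A *v m" "\<forall>j. j \<notin> set xs \<longrightarrow> m $ j = 0"
    using reflection_product_displacement by blast
  have "reflection_product A xs v = simple_reflection A x v"
    using Cons.prems(2) simple_reflection_involutive[of x "reflection_product A xs v"] by simp
  then have "A *v m = A *v (v $ x *s axis x 1)"
    by (simp add: simple_reflection_def matrix_vector_mult_scale mult_axis flip: m(1))
  then have m_eq: "m = v $ x *s axis x 1" by (rule mult_inj)
  moreover have "m $ x = 0" using m(2) Cons.prems(1) by simp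
  ultimately have x: "v $ x = 0" by simp
  then have "m = 0" using m_eq by (simp add: vec_eq_iff)
  then have "reflection_product A xs v = v" using m(1) by (simp add: matrix_vector_mult_zero)
  then show ?case using Cons x by auto
qed simp

section \<open>The order on weights\<close>

lemma weight_ge_iff: "weight_ge A \<mu> \<nu> \<longleftrightarrow> (\<exists>m. nonneg m \<and> \<mu> - \<nu> = A *v m)"
proof
  assume "weight_ge A \<mu> \<nu>"
  then obtain f where "\<mu> - \<nu> = (\<Sum>i\<in>UNIV. int (f i) *s simple_root A i)"
    unfolding weight_ge_def by blast
  then have "\<mu> - \<nu> = A *v (\<chi> i. int (f i))" by (simp add: matrix_vector_mult_eq)
  moreover have "nonneg (\<chi> i. int (f i))" by (simp add: nonneg_def)
  ultimately show "\<exists>m. nonneg m \<and> \<mu> - \<nu> = A *v m" by blast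
next
  assume "\<exists>m. nonneg m \<and> \<mu> - \<nu> = A *v m"
  then obtain m where "nonneg m" "\<mu> - \<nu> = A *v m" by blast
  then show "weight_ge A \<mu> \<nu>"
    unfolding weight_ge_def
    by (intro exI[of _ "\<lambda>i. nat (m $ i)"]) (simp add: matrix_vector_mult_eq nonneg_def)
qed

lemma weight_gt_irrefl: "\<not> weight_gt A \<mu> \<mu>"
  by (simp add: weight_gt_def)

lemma weight_gt_trans:
  assumes "weight_gt A \<kappa> \<mu>" "weight_gt A \<mu> \<nu>"
  shows "weight_gt A \<kappa> \<nu>"
proof -
  obtain m n where mn: "nonneg m" "\<kappa> - \<mu> = A *v m" "nonneg n" "\<mu> - \<nu> = A *v n"
    using assms unfolding weight_gt_def weight_ge_iff by blast
  have sum: "\<kappa> - \<nu> = A *v (m + n)"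
    by (simp add: matrix_vector_mult_add flip: mn(2,4))
  moreover have "nonneg (m + n)" using mn by (intro nonneg_add)
  ultimately have "weight_ge A \<kappa> \<nu>" unfolding weight_ge_iff by blast
  moreover have "\<kappa> \<noteq> \<nu>"
  proof
    assume "\<kappa> = \<nu>"
    then have "A *v n = A *v (- m)" using mn(2,4) by (simp add: matrix_vector_mult_uminus algebra_simps)
    then have "n = - m" by (rule mult_inj)
    then have "m = 0" using mn(1,3) nonneg_antisym by blast
    then show False using mn(2) assms(1) by (simp add: matrix_vector_mult_zero weight_gt_def)
  qed
  ultimately show ?thesis by (simp add: weight_gt_def)
qed

lemma weight_gt_chain:
  assumes "\<And>k. k < h \<Longrightarrow> weight_gt A (f k) (f (Suc k))" "k < l" "l \<le> h"
  shows "weight_gt A (f k) (f l)"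
  using assms(2,3)
proof (induction l)
  case (Suc l)
  then show ?case using assms(1)[of l] weight_gt_trans by (cases "k = l") auto
qed simp

section \<open>Components of the Coxeter graph\<close>

lemma cartan_zero_symmetric: "A $ i $ j = 0 \<longleftrightarrow> A $ j $ i = 0"
  using symmetrized[of i j] d_pos[of i] d_pos[of j] by auto

lemma component_closed:
  assumes "j \<in> coxeter_component A i" "k \<notin> coxeter_component A i"
  shows "A $ j $ k = 0" "A $ k $ j = 0"
proof -
  show "A $ j $ k = 0"
  proof (rule ccontr)
    assume "A $ j $ k \<noteq> 0"
    then have "(j, k) \<in> coxeter_edges A" using assms by (auto simp: coxeter_edges_def)
    then have "k \<in> coxeter_component A i"
      using assms(1) by (simp add: coxeter_component_def rtrancl.rtrancl_into_rtrancl)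
    then show False using assms(2) by blast
  qed
  then show "A $ k $ j = 0" by (simp add: cartan_zero_symmetric)
qed

lemma in_component: "i \<in> coxeter_component A i"
  by (simp add: coxeter_component_def)

lemma reflection_product_support:
  assumes "\<And>k. k \<notin> coxeter_component A i \<Longrightarrow> v $ k = 0" "k \<notin> coxeter_component A i"
  shows "reflection_product A xs v $ k = 0"
  using assms(2)
proof (induction xs arbitrary: k)
  case (Cons x xs)
  then show ?case
    using component_closed[of x i k]
    by (cases "x \<in> coxeter_component A i") (simp_all add: simple_reflection_nth)
qed (simp add: assms(1))

lemma root_product_support:
  assumes "\<And>k. k \<notin> coxeter_component A i \<Longrightarrow> m $ k = 0" "k \<notin> coxeter_component A i"
  shows "root_product A xs m $ k = 0"
  using assms(2)
proof (induction xs arbitrary: k)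
  case (Cons x xs)
  have "A $ k $ b * root_product A xs m $ b = 0" for b
    using Cons component_closed(2)[of b i k] by (cases "b \<in> coxeter_component A i") simp_all
  then have "(A *v root_product A xs m) $ k = 0"
    unfolding matrix_vector_mult_def vec_lambda_beta by (intro sum.neutral) blast
  then show ?case using Cons by (auto simp: root_reflection_nth)
qed (simp add: assms(1))

definition component_roots :: "'n \<Rightarrow> (int^'n) set" where
  "component_roots i = {m \<in> roots. \<forall>k. k \<notin> coxeter_component A i \<longrightarrow> m $ k = 0}"

end

section \<open>Coxeter elements\<close>

locale coxeter_word = finite_type_cartan A d
  for A :: "int^'n^'n" and d +
  fixes w :: "'n list"
  assumes distinct_word: "distinct w" and set_word: "set w = UNIV"
begin

abbreviation c :: "int^'n \<Rightarrow> int^'n" where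
  "c \<equiv> reflection_product A w"

abbreviation c_root :: "int^'n \<Rightarrow> int^'n" where
  "c_root \<equiv> root_product A w"

section \<open>The inversions of the inverse Coxeter element\<close>

text \<open>These are the inversions of the inverse of \<open>c\<close>, indexed by the letter
  \<open>i\<close> instead of its position in the word.\<close>

definition beta :: "'n \<Rightarrow> int^'n" where
  "beta i = root_product A (takeWhile (\<lambda>j. j \<noteq> i) w) (axis i 1)"

lemma beta_eq:
  assumes "w = us @ i # vs"
  shows "beta i = root_product A us (axis i 1)"
proof -
  have "i \<notin> set us" using distinct_word assms by auto
  then have "takeWhile (\<lambda>j. j \<noteq> i) w = us"
    unfolding assms by (subst takeWhile_append2) auto
  then show ?thesis by (simp add: beta_def)
qed

lemma word_split:
  obtains us vs where "w = us @ i # vs" "i \<notin> set us" "i \<notin> set vs"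
    "beta i = root_product A us (axis i 1)"
proof -
  obtain us vs where w: "w = us @ i # vs" using set_word split_list[of i w] by auto
  then have "i \<notin> set us" "i \<notin> set vs" using distinct_word by auto
  then show ?thesis by (rule that[OF w _ _ beta_eq[OF w]])
qed

text \<open>The letters before \<open>i\<close> leave coefficient \<open>i\<close> alone. One
  positive coefficient is enough to make the root \<open>beta i\<close> positive.\<close>

lemma beta_nth: "beta i $ i = 1"
proof -
  obtain us vs where "i \<notin> set us" "beta i = root_product A us (axis i 1)" by (rule word_split)
  then show ?thesis by (simp add: root_product_nth_other)
qed

lemma beta_in_roots: "beta i \<in> roots"
  by (simp add: beta_def root_product_in_roots axis_in_roots)

lemma nonneg_beta: "nonneg (beta i)"
proof -
  have "\<not> nonneg (- beta i)"
    unfolding nonneg_def using beta_nth[of i] by (auto intro!: exI[of _ i])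
  then show ?thesis using root_sign beta_in_roots by blast
qed

text \<open>The letters after \<open>i\<close> fix the fundamental weight, \<open>i\<close>
  subtracts its simple root, and the letters before \<open>i\<close> turn that root into
  \<open>beta i\<close>.\<close>

lemma fundamental_minus_c: "fundamental_weight i - c (fundamental_weight i) = A *v beta i"
proof -
  obtain us vs where w: "w = us @ i # vs" "i \<notin> set us" "i \<notin> set vs"
    "beta i = root_product A us (axis i 1)" by (rule word_split)
  then show ?thesis
    by (simp add: reflection_product_fundamental_other simple_reflection_fundamental
        reflection_product_diff reflection_product_mult)
qed

lemma c_eq_self:
  assumes "c v = v"
  shows "v = 0"
proof -
  have "v $ j = 0" for j
    using fixed_by_distinct_product[OF distinct_word assms] by (simp only: set_word UNIV_I)
  then show ?thesis by (simp add: vec_eq_iff)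
qed

lemma c_root_eq_self: "c_root m = m \<Longrightarrow> m = 0"
proof -
  assume "c_root m = m"
  then have "A *v m = 0" by (intro c_eq_self) (simp add: reflection_product_mult)
  then show "m = 0" using mult_inj[of m 0] by (simp add: matrix_vector_mult_zero)
qed

lemma c_power_mult: "(c ^^ k) (A *v m) = A *v (c_root ^^ k) m"
  by (simp add: reflection_product_power root_product_power reflection_product_mult)

lemma c_root_power_in_roots: "m \<in> roots \<Longrightarrow> (c_root ^^ k) m \<in> roots"
  by (simp add: root_product_power root_product_in_roots)

lemma c_power_diff: "(c ^^ k) (\<mu> - \<nu>) = (c ^^ k) \<mu> - (c ^^ k) \<nu>"
  by (simp add: reflection_product_power reflection_product_diff)

lemma c_power_uminus: "(c ^^ k) (- \<mu>) = - (c ^^ k) \<mu>"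
  by (simp add: reflection_product_power reflection_product_minus)

lemma c_root_power_uminus: "(c_root ^^ k) (- m) = - (c_root ^^ k) m"
  by (simp add: root_product_power root_product_minus)

lemma inj_c_root: "inj c_root"
  by (metis injI root_product_rev)

lemma inj_c_root_power: "inj (c_root ^^ k)"
  by (rule inj_fn) (rule inj_c_root)

lemma c_power_beta: "(c ^^ k) (fundamental_weight i) - (c ^^ Suc k) (fundamental_weight i) = A *v (c_root ^^ k) (beta i)"
  by (simp add: funpow_swap1 flip: c_power_mult fundamental_minus_c c_power_diff)

text \<open>The image is a positive root that the inverse of \<open>c\<close> makes negative, hence
  one of its inversions.\<close>

lemma root_entering_positive:
  assumes "m \<in> roots" "\<not> nonneg m" "nonneg (c_root m)"
  obtains t where "c_root m = beta t"
proof -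
  have "\<not> nonneg (root_product A (rev w) (c_root m))" using assms by (simp add: root_product_rev)
  moreover have "c_root m \<in> roots" using assms by (simp add: root_product_in_roots)
  ultimately obtain us t vs where "w = us @ t # vs" "c_root m = root_product A us (axis t 1)"
    using inverted_root assms(3) by blast
  then show ?thesis using that beta_eq by metis
qed

text \<open>
  Otherwise the sum over the orbit of \<open>m\<close> would be a nonzero fixed vector of \<open>c\<close>.
\<close>

lemma orbit_has_nonpos:
  assumes "m \<in> roots"
  shows "\<exists>k. nonneg (- (c_root ^^ k) m)"
proof (rule ccontr)
  assume "\<not> ?thesis"
  then have pos: "nonneg ((c_root ^^ k) m)" for k
    using root_sign c_root_power_in_roots assms by blast
  have "{y. \<exists>n. y = (c_root ^^ n) m} \<subseteq> roots" using c_root_power_in_roots assms by blast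
  then obtain n where n: "n > 0" "(c_root ^^ n) m = m"
    using funpow_inj_finite[OF inj_c_root] finite_roots finite_subset by blast
  let ?S = "\<Sum>k<n. (c_root ^^ k) m"
  have "c_root ?S = (\<Sum>k<n. (c_root ^^ Suc k) m)" by (simp add: root_product_sum)
  also have "\<dots> = ?S"
    using n(2) sum.lessThan_Suc_shift[of "\<lambda>k. (c_root ^^ k) m" n]
    by (simp add: sum.lessThan_Suc add.commute)
  finally have "?S = 0" by (rule c_root_eq_self)
  have "m $ j = 0" for j
  proof -
    have "(\<Sum>k<n. (c_root ^^ k) m $ j) = 0"
      using \<open>?S = 0\<close> by (simp flip: sum_component)
    then have "\<forall>k\<in>{..<n}. (c_root ^^ k) m $ j = 0"
      using pos by (subst (asm) sum_nonneg_eq_0_iff) (auto simp: nonneg_def)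
    then show ?thesis using n(1) by (auto dest: bspec[of _ _ 0])
  qed
  then have "m = 0" by (simp add: vec_eq_iff)
  then show False using root_nonzero assms by blast
qed

section \<open>Chains from fundamental weights to their negatives\<close>

lemma orbit_reaches_minus_fundamental:
  "\<exists>h>0. (\<forall>k<h. nonneg ((c_root ^^ k) (beta i)))
    \<and> (\<exists>j. (c ^^ h) (fundamental_weight i) = - fundamental_weight j)"
proof -
  define h where "h = (LEAST k. nonneg (- (c_root ^^ k) (beta i)))"
  have h: "nonneg (- (c_root ^^ h) (beta i))"
    unfolding h_def by (rule LeastI_ex) (rule orbit_has_nonpos[OF beta_in_roots])
  have before: "\<not> nonneg (- (c_root ^^ k) (beta i))" if "k < h" for k
    using that not_less_Least unfolding h_def by blast
  have "h \<noteq> 0"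
    using h nonneg_beta[of i] nonneg_antisym root_nonzero[OF beta_in_roots] by (cases h) auto
  then obtain g where g: "h = Suc g" using not0_implies_Suc by blast
  \<comment> \<open>With signs reversed, the step from \<open>g\<close> to \<open>h\<close> enters
    the positive roots, so it arrives at some \<open>beta j\<close>.\<close>
  have "c_root (- (c_root ^^ g) (beta i)) = - (c_root ^^ h) (beta i)"
    by (simp add: g root_product_minus)
  moreover have "- (c_root ^^ g) (beta i) \<in> roots"
    by (intro uminus_in_roots c_root_power_in_roots beta_in_roots)
  ultimately obtain j where j: "- (c_root ^^ h) (beta i) = beta j"
    using root_entering_positive[of "- (c_root ^^ g) (beta i)"] before[of g] h g by (metis lessI)
  \<comment> \<open>The next differences of the two summands cancel, so \<open>c\<close> fixes this
    sum, which must then be zero.\<close>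
  let ?v = "(c ^^ h) (fundamental_weight i) + fundamental_weight j"
  have "(c ^^ h) (fundamental_weight i) - (c ^^ Suc h) (fundamental_weight i)
      = - (fundamental_weight j - c (fundamental_weight j))"
    unfolding c_power_beta fundamental_minus_c j[symmetric] by (simp add: matrix_vector_mult_uminus)
  moreover have "a - b = - (e - f) \<Longrightarrow> a + e = b + f" for a b e f :: "int^'n"
    by (simp add: algebra_simps)
  ultimately have "?v = (c ^^ Suc h) (fundamental_weight i) + c (fundamental_weight j)" by blast
  also have "\<dots> = c ?v" by (simp add: reflection_product_add)
  finally have "c ?v = ?v" ..
  then have "?v = 0" by (rule c_eq_self)
  then have "(c ^^ h) (fundamental_weight i) = - fundamental_weight j"
    by (simp add: add_eq_0_iff2)
  moreover have "\<forall>k<h. nonneg ((c_root ^^ k) (beta i))"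
    using before root_sign c_root_power_in_roots beta_in_roots by blast
  ultimately show ?thesis using \<open>h \<noteq> 0\<close> by blast
qed

text \<open>A strictly descending chain takes each value at most once, so the length in the
  \<open>THE\<close> is unique.\<close>

lemma chain_length_properties:
  shows "chain_length A c i > 0"
    and "k < chain_length A c i \<Longrightarrow> weight_gt A ((c ^^ k) (fundamental_weight i)) ((c ^^ Suc k) (fundamental_weight i))"
    and "(c ^^ chain_length A c i) (fundamental_weight i) = - fundamental_weight (star A i)"
    and "star A (star A i) = i"
proof -
  let ?f = "\<lambda>k. (c ^^ k) (fundamental_weight i)"
  obtain h j where h: "h > 0" "\<And>k. k < h \<Longrightarrow> nonneg ((c_root ^^ k) (beta i))" "?f h = - fundamental_weight j"
    using orbit_reaches_minus_fundamental by blast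
  have star: "star A i = j" "star A j = i"
    using star_eqI h(3) by (simp_all add: reflection_product_power)
  then show "star A (star A i) = i" by simp
  have gt: "weight_gt A (?f k) (?f (Suc k))" if "k < h" for k
  proof -
    let ?m = "(c_root ^^ k) (beta i)"
    have diff: "?f k - ?f (Suc k) = A *v ?m" by (rule c_power_beta)
    have "?f k \<noteq> ?f (Suc k)"
    proof
      assume "?f k = ?f (Suc k)"
      then have "A *v ?m = A *v 0" unfolding diff[symmetric] matrix_vector_mult_zero by simp
      then have "?m = 0" by (rule mult_inj)
      then show False using root_nonzero c_root_power_in_roots beta_in_roots by blast
    qed
    moreover have "weight_ge A (?f k) (?f (Suc k))"
      unfolding weight_ge_iff using h(2)[OF that] diff by blast
    ultimately show ?thesis by (simp add: weight_gt_def)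
  qed
  have length: "chain_length A c i = h"
    unfolding chain_length_def
  proof (rule the_equality)
    show "h > 0 \<and> (\<forall>k<h. weight_gt A (?f k) (?f (Suc k))) \<and> ?f h = - fundamental_weight (star A i)"
      using h gt star by blast
  next
    fix g
    assume g: "g > 0 \<and> (\<forall>k<g. weight_gt A (?f k) (?f (Suc k))) \<and> ?f g = - fundamental_weight (star A i)"
    then have eq: "?f g = ?f h" using h star by simp
    have "\<not> g < h"
      using weight_gt_chain[of h ?f g h] gt eq weight_gt_irrefl by auto
    moreover have "\<not> h < g"
      using weight_gt_chain[of g ?f h g] g eq weight_gt_irrefl by auto
    ultimately show "g = h" by simp
  qed
  show "chain_length A c i > 0" unfolding length by (rule h)
  show "weight_gt A (?f k) (?f (Suc k))" if "k < chain_length A c i"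
    by (rule gt) (use that in \<open>simp only: length\<close>)
  show "?f (chain_length A c i) = - fundamental_weight (star A i)" unfolding length star(1) by (rule h)
qed


section \<open>Equality of periods on a component\<close>

lemma c_power_displacement:
  "\<exists>m. nonneg m \<and> fundamental_weight l - (c ^^ k) (fundamental_weight l) = A *v m \<and> (m $ l = 0 \<longrightarrow> m = 0)"
  unfolding reflection_product_power by (rule fundamental_displacement)

text \<open>Expand the simple root in fundamental weights and apply \<open>us\<close>. A weight
  whose letter lies in \<open>us\<close> is fixed by the rest of \<open>w\<close>, so
  \<open>us\<close> acts on it as \<open>c\<close>; the other weights are fixed by
  \<open>us\<close>.\<close>

lemma simple_root_mesh:
  assumes w: "w = us @ i # vs"
  shows "A *v beta i = (\<Sum>l\<in>UNIV. A $ l $ i *s (if l \<in> set us then c (fundamental_weight l) else fundamental_weight l))"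
proof -
  have "reflection_product A us (fundamental_weight l)
    = (if l \<in> set us then c (fundamental_weight l) else fundamental_weight l)" for l
  proof (cases "l \<in> set us")
    case True
    then have l: "l \<notin> set (i # vs)" using distinct_word w by auto
    have "c (fundamental_weight l) = reflection_product A us (fundamental_weight l)"
      unfolding w reflection_product_append comp_apply reflection_product_fundamental_other[OF l] ..
    then show ?thesis using True by simp
  qed (simp add: reflection_product_fundamental_other)
  then show ?thesis
    by (simp add: beta_eq[OF w] mult_axis simple_root_def reflection_product_sum reflection_product_scale
        flip: reflection_product_mult)
qed

text \<open>
  If \<open>c\<^sup>k\<close> fixes \<open>\<omega>\<^sub>i\<close>, it fixes both sides of the mesh relation above.  The displacements of the
  \<open>\<omega>\<^sub>l\<close> under powers of \<open>c\<close> then add up to a combination of the roots \<open>beta l\<close> with \<open>l\<close> before \<open>i\<close>, which do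
  not involve the simple roots after \<open>i\<close>.
\<close>

lemma period_later_neighbour:
  assumes w: "w = us @ i # vs" and j: "j \<in> set vs" "A $ j $ i \<noteq> 0"
    and fixed: "(c ^^ k) (fundamental_weight i) = fundamental_weight i"
  shows "(c ^^ k) (fundamental_weight j) = fundamental_weight j"
proof -
  define g where "g l = (if l \<in> set us then c (fundamental_weight l) else fundamental_weight l :: int^'n)" for l
  define b where "b l = (if l \<in> set us then beta l else 0)" for l
  define e where "e l = (if l \<in> set us then Suc k else k)" for l
  have "\<forall>l. \<exists>m. nonneg m \<and> fundamental_weight l - (c ^^ e l) (fundamental_weight l) = A *v m
      \<and> (m $ l = 0 \<longrightarrow> m = 0)"
    using c_power_displacement by blast
  from choice[OF this] obtain m where m: "\<And>l. nonneg (m l)"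
    "\<And>l. fundamental_weight l - (c ^^ e l) (fundamental_weight l) = A *v m l"
    "\<And>l. m l $ l = 0 \<Longrightarrow> m l = 0"
    by blast
  \<comment> \<open>Column \<open>i\<close> has its only positive entry on the diagonal; with this
    term gone all remaining summands have one sign.\<close>
  have mi: "m i = 0"
  proof -
    have "i \<notin> set us" using distinct_word w by auto
    then have "A *v m i = A *v 0"
      using m(2)[of i] fixed by (simp add: e_def matrix_vector_mult_zero)
    then show ?thesis by (rule mult_inj)
  qed
  have g: "g l - (c ^^ k) (g l) = A *v (m l - b l)" for l
  proof (cases "l \<in> set us")
    case True
    have "(c ^^ k) (c (fundamental_weight l)) = fundamental_weight l - A *v m l"
      using True by (simp add: e_def funpow_swap1 flip: m(2))
    moreover have "c (fundamental_weight l) = fundamental_weight l - A *v beta l"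
      by (simp flip: fundamental_minus_c)
    ultimately show ?thesis using True by (simp add: g_def b_def matrix_vector_mult_minus)
  qed (simp add: g_def b_def e_def flip: m(2))
  have "(c ^^ k) (A *v beta i) = A *v beta i"
    by (simp add: c_power_diff fixed funpow_swap1 flip: fundamental_minus_c)
      (simp add: fixed flip: funpow_swap1)
  then have "(\<Sum>l\<in>UNIV. A $ l $ i *s (g l - (c ^^ k) (g l))) = 0"
    unfolding simple_root_mesh[OF w] g_def[symmetric] reflection_product_power
    by (simp add: reflection_product_sum reflection_product_scale vector_ssub_ldistrib sum_subtractf)
  then have "A *v (\<Sum>l\<in>UNIV. A $ l $ i *s (m l - b l)) = A *v 0"
    by (simp only: g matrix_vector_mult_sum matrix_vector_mult_scale matrix_vector_mult_zero)
  then have "(\<Sum>l\<in>UNIV. A $ l $ i *s (m l - b l)) = 0" by (rule mult_inj)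
  then have "(\<Sum>l\<in>UNIV. A $ l $ i * (m l $ j - b l $ j)) = 0"
    by (auto simp: vec_eq_iff right_diff_distrib)
  moreover have "b l $ j = 0" for l
  proof (cases "l \<in> set us")
    case True
    then obtain us1 us2 where us: "us = us1 @ l # us2" by (meson split_list)
    then have "w = us1 @ l # (us2 @ i # vs)" by (simp add: w)
    then have "beta l = root_product A us1 (axis l 1)" by (rule beta_eq)
    moreover have "j \<notin> set us1" "j \<noteq> l" using distinct_word w us j(1) by auto
    ultimately show ?thesis by (simp add: b_def root_product_nth_other axis_def)
  qed (simp add: b_def)
  ultimately have "(\<Sum>l\<in>UNIV. - (A $ l $ i * m l $ j)) = 0" by (simp add: sum_negf)
  moreover have "0 \<le> - (A $ l $ i * m l $ j)" for l
  proof (cases "l = i")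
    case False
    then have "A $ l $ i \<le> 0" by (rule off_diag)
    moreover have "0 \<le> m l $ j" using m(1) by (simp add: nonneg_def)
    ultimately show ?thesis by (simp add: mult_nonpos_nonneg)
  qed (simp add: mi)
  ultimately have "- (A $ j $ i * m j $ j) = 0"
    by (subst (asm) sum_nonneg_eq_0_iff) auto
  then have "m j = 0" using j(2) m(3) by simp
  moreover have "e j = k" using distinct_word w j(1) by (auto simp: e_def)
  ultimately show ?thesis using m(2)[of j] by (simp add: matrix_vector_mult_zero)
qed

lemma coxeter_word_rev: "coxeter_word A d (rev w)"
  by unfold_locales (simp_all add: distinct_word set_word)

text \<open>The reversed word represents the inverse of \<open>c\<close>, and a map and its inverse
  have the same fixed vectors.\<close>

lemma c_power_rev: "(reflection_product A (rev w) ^^ k) \<mu> = \<mu> \<longleftrightarrow> (c ^^ k) \<mu> = \<mu>"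
proof -
  have "reflection_product A (rev w) ^^ k = reflection_product A (rev (concat (replicate k w)))"
    by (simp add: reflection_product_power rev_concat)
  then show ?thesis
    unfolding reflection_product_power by (metis reflection_product_rev reflection_product_rev')
qed

text \<open>A neighbour that precedes \<open>i\<close> in \<open>w\<close> follows it in the
  reversed word, which has the same periods.\<close>

lemma period_neighbour:
  assumes "(i, j) \<in> coxeter_edges A" "(c ^^ k) (fundamental_weight i) = fundamental_weight i"
  shows "(c ^^ k) (fundamental_weight j) = fundamental_weight j"
proof -
  have ij: "i \<noteq> j" "A $ j $ i \<noteq> 0"
    using assms(1) cartan_zero_symmetric by (auto simp: coxeter_edges_def)
  obtain us vs where w: "w = us @ i # vs" by (rule word_split)
  have "j \<in> set w" by (simp add: set_word)
  then consider "j \<in> set vs" | "j \<in> set us" using ij(1) unfolding w by auto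
  then show ?thesis
  proof cases
    case 1
    then show ?thesis using period_later_neighbour w ij(2) assms(2) by blast
  next
    case 2
    interpret reversed: coxeter_word A d "rev w" by (rule coxeter_word_rev)
    have "rev w = rev vs @ i # rev us" by (simp add: w)
    moreover have "j \<in> set (rev us)" using 2 by simp
    ultimately show ?thesis
      using reversed.period_later_neighbour ij(2) assms(2) unfolding c_power_rev by blast
  qed
qed

lemma period_component:
  assumes "j \<in> coxeter_component A i"
  shows "(c ^^ k) (fundamental_weight j) = fundamental_weight j
    \<longleftrightarrow> (c ^^ k) (fundamental_weight i) = fundamental_weight i"
proof -
  have sym: "(b, a) \<in> coxeter_edges A" if "(a, b) \<in> coxeter_edges A" for a b
    using that cartan_zero_symmetric by (auto simp: coxeter_edges_def)
  have "(i, j) \<in> (coxeter_edges A)\<^sup>*" using assms by (simp add: coxeter_component_def)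
  then show ?thesis
    by induction (use period_neighbour sym in blast)+
qed

text \<open>Two chains in succession lead to the negative of the star weight and back. Strict
  descent excludes an earlier return: in the second chain it would mean reaching
  \<open>- fundamental_weight i\<close> too soon.\<close>

lemma period_fundamental:
  fixes i
  defines "N \<equiv> chain_length A c i + chain_length A c (star A i)"
  shows "N > 0" "(c ^^ N) (fundamental_weight i) = fundamental_weight i"
    and "0 < k \<Longrightarrow> k < N \<Longrightarrow> (c ^^ k) (fundamental_weight i) \<noteq> fundamental_weight i"
proof -
  let ?h = "chain_length A c i" and ?h' = "chain_length A c (star A i)"
  let ?f = "\<lambda>k. (c ^^ k) (fundamental_weight i)" and ?f' = "\<lambda>k. (c ^^ k) (fundamental_weight (star A i))"
  note props = chain_length_properties
  have shift: "?f (k + ?h) = - ?f' k" for k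
    by (simp add: funpow_add props(3) c_power_uminus)
  show "N > 0" using props(1)[of i] by (simp add: N_def)
  show "?f N = fundamental_weight i"
    using shift[of ?h'] props(3)[of "star A i"] props(4) by (simp add: N_def add.commute)
  show "?f k \<noteq> fundamental_weight i" if k: "0 < k" "k < N"
  proof (cases "k \<le> ?h")
    case True
    have "weight_gt A (?f 0) (?f k)"
      by (rule weight_gt_chain[where h = "?h" and f = "?f", OF props(2) k(1) True])
    then show ?thesis using weight_gt_irrefl[of "fundamental_weight i"] by auto
  next
    case False
    then obtain k' where k': "k = k' + ?h" using le_Suc_ex[of ?h k] by (auto simp: add.commute)
    then have less: "k' < ?h'" using k(2) by (simp add: N_def)
    have "weight_gt A (?f' k') (?f' ?h')"
      by (rule weight_gt_chain[where h = "?h'" and f = "?f'", OF props(2) less order_refl])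
    then have "?f' k' \<noteq> - fundamental_weight i"
      using weight_gt_irrefl props(3)[of "star A i"] props(4) by auto
    then show ?thesis unfolding k' shift by (simp add: minus_equation_iff)
  qed
qed

text \<open>Powers of \<open>c\<close> keep a weight supported on its component.\<close>

lemma star_in_component: "star A i \<in> coxeter_component A i"
proof (rule ccontr)
  assume not_in: "star A i \<notin> coxeter_component A i"
  have "(c ^^ chain_length A c i) (fundamental_weight i) $ star A i = 0"
    unfolding reflection_product_power
    by (rule reflection_product_support[OF _ not_in]) (use in_component in \<open>auto simp: fundamental_weight_nth\<close>)
  then show False by (simp add: chain_length_properties(3) fundamental_weight_nth)
qed

section \<open>Counting the roots of a component\<close>

lemma c_root_power_component: "m \<in> component_roots i \<Longrightarrow> (c_root ^^ k) m \<in> component_roots i"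
  using root_product_support[of i m]
  by (auto simp: component_roots_def root_product_power root_product_in_roots)

lemma beta_in_component_roots: "beta j \<in> component_roots i \<longleftrightarrow> j \<in> coxeter_component A i"
proof
  assume "beta j \<in> component_roots i"
  then show "j \<in> coxeter_component A i"
    using beta_nth[of j] by (auto simp: component_roots_def)
next
  assume "j \<in> coxeter_component A i"
  then have "axis j 1 $ k = (0 :: int)" if "k \<notin> coxeter_component A i" for k
    using that by (auto simp: axis_def)
  then show "beta j \<in> component_roots i"
    using beta_in_roots root_product_support[of i "axis j 1"] unfolding beta_def component_roots_def by blast
qed

text \<open>The orbit contains a negative root and, by the same fact for its negative, later a
  positive one. It crosses over at some \<open>beta t\<close>.\<close>

lemma orbit_meets_beta:
  assumes "m \<in> roots"
  shows "\<exists>k t. (c_root ^^ k) m = beta t"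
proof -
  obtain k where k: "nonneg (- (c_root ^^ k) m)" using orbit_has_nonpos assms by blast
  let ?n = "(c_root ^^ k) m"
  have n: "?n \<in> roots" "- ?n \<in> roots" using assms c_root_power_in_roots uminus_in_roots by blast+
  obtain l where l: "nonneg ((c_root ^^ l) ?n)"
    using orbit_has_nonpos[OF n(2)] by (auto simp: c_root_power_uminus)
  define h where "h = (LEAST l. nonneg ((c_root ^^ l) ?n))"
  have h: "nonneg ((c_root ^^ h) ?n)" unfolding h_def using l by (rule LeastI)
  have "h \<noteq> 0" using h k nonneg_antisym root_nonzero[OF n(1)] by (cases h) auto
  then obtain g where g: "h = Suc g" using not0_implies_Suc by blast
  have "\<not> nonneg ((c_root ^^ g) ?n)" by (rule not_less_Least) (simp add: g flip: h_def)
  moreover have "(c_root ^^ g) ?n \<in> roots" using n(1) by (rule c_root_power_in_roots)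
  moreover have "nonneg (c_root ((c_root ^^ g) ?n))" using h by (simp add: g)
  ultimately obtain t where "c_root ((c_root ^^ g) ?n) = beta t" using root_entering_positive by blast
  then have "(c_root ^^ (Suc g + k)) m = beta t" by (simp add: funpow_add)
  then show ?thesis by blast
qed

text \<open>The pairs of \<open>j\<close> in the component and \<open>k < N\<close> correspond
  bijectively to the roots \<open>(c_root ^^ k) (beta j)\<close>.\<close>

lemma card_component_roots:
  assumes N: "N > 0" "(c ^^ N) (fundamental_weight i) = fundamental_weight i"
    "\<And>k. 0 < k \<Longrightarrow> k < N \<Longrightarrow> (c ^^ k) (fundamental_weight i) \<noteq> fundamental_weight i"
  shows "card (component_roots i) = card (coxeter_component A i) * N"
proof -
  let ?J = "coxeter_component A i"
  have period: "(c_root ^^ N) (beta j) = beta j" if j: "j \<in> ?J" for j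
  proof -
    have "(c ^^ N) (fundamental_weight j) = fundamental_weight j" using period_component[OF j] N(2) by blast
    then have "(c ^^ N) (A *v beta j) = A *v beta j"
      by (simp add: c_power_diff funpow_swap1 flip: fundamental_minus_c) (simp flip: funpow_swap1)
    then have "A *v (c_root ^^ N) (beta j) = A *v beta j" by (simp add: c_power_mult)
    then show ?thesis by (rule mult_inj)
  qed
  \<comment> \<open>The difference \<open>?v\<close> is fixed by \<open>c\<close>, hence zero. Two
    fundamental weights in one orbit coincide, so \<open>r\<close> is a period below
    \<open>N\<close>.\<close>
  have inj: "j = j' \<and> r = 0" if r: "beta j = (c_root ^^ r) (beta j')" "r < N" and j: "j \<in> ?J" for j j' r
  proof -
    let ?v = "fundamental_weight j - (c ^^ r) (fundamental_weight j')"
    have "fundamental_weight j - c (fundamental_weight j)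
      = (c ^^ r) (fundamental_weight j') - (c ^^ Suc r) (fundamental_weight j')"
      unfolding c_power_beta fundamental_minus_c r(1) ..
    moreover have "a - b = p - q \<Longrightarrow> b - q = a - p" for a b p q :: "int^'n"
      by (simp add: algebra_simps)
    ultimately have "c (fundamental_weight j) - (c ^^ Suc r) (fundamental_weight j') = ?v" by blast
    then have "c ?v = ?v" by (simp add: reflection_product_diff)
    then have "?v = 0" by (rule c_eq_self)
    then have eq: "(c ^^ r) (fundamental_weight j') = fundamental_weight j" by simp
    then have "fundamental_weight j = fundamental_weight j'"
      using dominant_in_orbit_unique[OF nonneg_fundamental] nonneg_fundamental
      unfolding reflection_product_power by metis
    then have "j = j'" by (simp add: fundamental_weight_eq_iff)
    moreover have "(c ^^ r) (fundamental_weight i) = fundamental_weight i"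
      using eq \<open>j = j'\<close> period_component[OF j] by simp
    then have "r = 0" using N(3)[of r] r(2) by blast
    ultimately show ?thesis ..
  qed
  have le: "(j, k) = (j', k')"
    if "(c_root ^^ k) (beta j) = (c_root ^^ k') (beta j')" "k \<le> k'" "k' < N" "j \<in> ?J" for j j' k k'
  proof -
    have "(c_root ^^ k') (beta j') = (c_root ^^ k) ((c_root ^^ (k' - k)) (beta j'))"
      using that(2) by (simp flip: funpow_add comp_apply[of "c_root ^^ k"])
    then have "beta j = (c_root ^^ (k' - k)) (beta j')"
      using that(1) inj_c_root_power by (metis injD)
    then have "j = j' \<and> k' - k = 0" using that(3,4) by (intro inj) auto
    then show ?thesis using that(2) by simp
  qed
  have "inj_on (\<lambda>(j, k). (c_root ^^ k) (beta j)) (?J \<times> {..<N})"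
  proof (rule inj_onI)
    fix x y
    assume xy: "x \<in> ?J \<times> {..<N}" "y \<in> ?J \<times> {..<N}"
      "(\<lambda>(j, k). (c_root ^^ k) (beta j)) x = (\<lambda>(j, k). (c_root ^^ k) (beta j)) y"
    obtain j k j' k' where p: "x = (j, k)" "y = (j', k')" by fastforce
    with xy have *: "j \<in> ?J" "k < N" "j' \<in> ?J" "k' < N" "(c_root ^^ k) (beta j) = (c_root ^^ k') (beta j')"
      by simp_all
    show "x = y"
    proof (cases "k \<le> k'")
      case True
      then show ?thesis using le[of k j k' j'] * by (simp add: p)
    next
      case False
      then show ?thesis using le[of k' j' k j] * by (simp add: p)
    qed
  qed
  moreover have "(\<lambda>(j, k). (c_root ^^ k) (beta j)) ` (?J \<times> {..<N}) = component_roots i"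
  proof
    show "(\<lambda>(j, k). (c_root ^^ k) (beta j)) ` (?J \<times> {..<N}) \<subseteq> component_roots i"
      using c_root_power_component beta_in_component_roots by auto
    show "component_roots i \<subseteq> (\<lambda>(j, k). (c_root ^^ k) (beta j)) ` (?J \<times> {..<N})"
    proof
      fix m assume m: "m \<in> component_roots i"
      then obtain k t where t: "(c_root ^^ k) m = beta t"
        using orbit_meets_beta unfolding component_roots_def by blast
      then have "t \<in> ?J" using m c_root_power_component beta_in_component_roots by metis
      \<comment> \<open>On the orbit of \<open>beta t\<close> this exponent inverts \<open>k\<close>
        steps, because \<open>k + q = N * k\<close>.\<close>
      define q where "q = N * k - k"
      have "k \<le> N * k" using N(1) by simp
      have powers: "(c_root ^^ (N * a)) (beta t) = beta t" for a
        by (induction a) (simp_all add: funpow_add period[OF \<open>t \<in> ?J\<close>])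
      have "(c_root ^^ k) ((c_root ^^ q) (beta t)) = (c_root ^^ (k + q)) (beta t)"
        by (simp add: funpow_add)
      also have "\<dots> = beta t" using \<open>k \<le> N * k\<close> powers by (simp add: q_def)
      finally have "(c_root ^^ q) (beta t) = m" using t inj_c_root_power by (metis injD)
      moreover have "(c_root ^^ q) (beta t) = (c_root ^^ (q mod N)) (beta t)"
      proof -
        have "(c_root ^^ q) (beta t) = (c_root ^^ (q mod N + N * (q div N))) (beta t)" by simp
        also have "\<dots> = (c_root ^^ (q mod N)) (beta t)"
          unfolding funpow_add comp_apply powers ..
        finally show ?thesis .
      qed
      moreover have "q mod N < N" using N(1) by simp
      ultimately show "m \<in> (\<lambda>(j, k). (c_root ^^ k) (beta j)) ` (?J \<times> {..<N})"
        using \<open>t \<in> ?J\<close> by force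
    qed
  qed
  ultimately have "card (component_roots i) = card (?J \<times> {..<N})" using card_image by fastforce
  then show ?thesis by (simp add: card_cartesian_product)
qed

end

context finite_type_cartan
begin

section \<open>Orders of Coxeter elements and the Coxeter number\<close>

lemma weyl_pow:
  "reflection_product A xs [^]\<^bsub>weyl_group A J\<^esub> (n :: nat) = reflection_product A xs ^^ n"
proof (induction n)
  case (Suc n)
  then show ?case
    using weyl_mult[of J "concat (replicate n xs)" xs]
    by (simp add: funpow_Suc_right[symmetric] del: funpow.simps flip: reflection_product_power)
qed (simp add: weyl_one)

lemma coxeter_word_extend:
  assumes "distinct js" "set js = J"
  obtains ks where "coxeter_word A d (js @ ks)" "set ks = - J"
proof -
  obtain ks where "set ks = - J" "distinct ks"
    using finite_distinct_list[of "- J"] by auto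
  moreover from this have "coxeter_word A d (js @ ks)"
    using assms by unfold_locales auto
  ultimately show ?thesis using that by blast
qed

text \<open>Along the orbit the weights stay supported on the component, where the letters of
  \<open>ks\<close> act trivially.\<close>

lemma parabolic_power:
  assumes "set js = coxeter_component A i" "set ks = - coxeter_component A i" "j \<in> coxeter_component A i"
  shows "(reflection_product A (js @ ks) ^^ n) (fundamental_weight j)
    = (reflection_product A js ^^ n) (fundamental_weight j)"
proof (induction n)
  case (Suc n)
  let ?v = "(reflection_product A js ^^ n) (fundamental_weight j)"
  have "?v $ k = 0" if "k \<in> set ks" for k
    unfolding reflection_product_power
  proof (rule reflection_product_support)
    show "k \<notin> coxeter_component A i" using that assms by simp
  qed (use assms(3) in \<open>auto simp: fundamental_weight_nth\<close>)
  then have "reflection_product A ks ?v = ?v" by (rule reflection_product_fixes)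
  then show ?case using Suc by simp
qed simp

text \<open>Extending \<open>js\<close> to a word in all letters makes the period and root count of
  a full Coxeter element available; its period on the weight of \<open>i\<close> is the order of the
  shorter product.\<close>

lemma coxeter_element_order:
  assumes js: "distinct js" "set js = coxeter_component A i"
  shows "card (coxeter_component A i) * group.ord (weyl_group A (coxeter_component A i)) (reflection_product A js)
    = card (component_roots i)"
proof -
  let ?J = "coxeter_component A i"
  let ?c = "reflection_product A js"
  let ?\<omega> = "fundamental_weight :: 'n \<Rightarrow> int^'n"
  obtain ks where ks: "coxeter_word A d (js @ ks)" "set ks = - ?J"
    using coxeter_word_extend[OF js] by blast
  interpret ext: coxeter_word A d "js @ ks" by (rule ks)
  interpret W: group "weyl_group A ?J" by (rule group_weyl)
  define N where "N = chain_length A ext.c i + chain_length A ext.c (star A i)"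
  note N = ext.period_fundamental[where i = i, folded N_def]
  \<comment> \<open>All fundamental weights of the component share one period, and \<open>js\<close>
    fixes the others.\<close>
  have power_id: "?c ^^ n = id \<longleftrightarrow> (ext.c ^^ n) (?\<omega> i) = ?\<omega> i" for n
  proof
    assume "?c ^^ n = id"
    then show "(ext.c ^^ n) (?\<omega> i) = ?\<omega> i"
      unfolding parabolic_power[OF js(2) ks(2) in_component] by simp
  next
    assume fixed: "(ext.c ^^ n) (?\<omega> i) = ?\<omega> i"
    have "(?c ^^ n) (?\<omega> j) = ?\<omega> j" for j
    proof (cases "j \<in> ?J")
      case True
      then show ?thesis
        using fixed ext.period_component[OF True] parabolic_power[OF js(2) ks(2) True] by simp
    next
      case False
      then show ?thesis
        unfolding reflection_product_power
        by (intro reflection_product_fundamental_other) (auto simp: js(2))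
    qed
    note * = this[unfolded reflection_product_power]
    have "reflection_product A (concat (replicate n js)) (\<Sum>j\<in>UNIV. \<mu> $ j *s ?\<omega> j)
        = (\<Sum>j\<in>UNIV. \<mu> $ j *s ?\<omega> j)" for \<mu>
      by (simp add: reflection_product_sum reflection_product_scale *)
    then show "?c ^^ n = id"
      by (simp add: fun_eq_iff reflection_product_power flip: weight_expansion)
  qed
  have "?c \<in> carrier (weyl_group A ?J)" using js(2) by (auto simp: carrier_weyl_group)
  then have dvd: "W.ord ?c dvd n \<longleftrightarrow> (ext.c ^^ n) (?\<omega> i) = ?\<omega> i" for n
    using W.pow_eq_id[of ?c n] by (simp add: weyl_pow weyl_one power_id)
  have "W.ord ?c dvd N" using dvd[of N] N(2) by simp
  then have "W.ord ?c > 0" "W.ord ?c \<le> N" using N(1) by (auto intro: dvd_pos_nat dvd_imp_le)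
  moreover have "(ext.c ^^ W.ord ?c) (?\<omega> i) = ?\<omega> i" using dvd[of "W.ord ?c"] by simp
  ultimately have "W.ord ?c = N" using N(3)[of "W.ord ?c"] by linarith
  then show ?thesis using ext.card_component_roots[OF N] by simp
qed

text \<open>The root count determines the order of every Coxeter element of the component, so the
  \<open>THE\<close> in \<open>coxeter_number\<close> has a unique candidate.\<close>

lemma coxeter_number_component:
  "card (coxeter_component A i) * coxeter_number A (coxeter_component A i) = card (component_roots i)"
proof -
  let ?J = "coxeter_component A i"
  have card: "card ?J > 0" using in_component by (auto simp: card_gt_0_iff)
  have order: "card ?J * group.ord (weyl_group A ?J) c = card (component_roots i)"
    if "c \<in> coxeter_elements A ?J" for c
    using that coxeter_element_order unfolding coxeter_elements_def by blast
  obtain js where "set js = ?J" "distinct js" using finite_distinct_list[of ?J] by auto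
  then have c: "reflection_product A js \<in> coxeter_elements A ?J" by (auto simp: coxeter_elements_def)
  have "coxeter_number A ?J = group.ord (weyl_group A ?J) (reflection_product A js)"
    unfolding coxeter_number_def
  proof (rule the_equality)
    show "\<forall>c\<in>coxeter_elements A ?J. group.ord (weyl_group A ?J) c
        = group.ord (weyl_group A ?J) (reflection_product A js)"
      using order order[OF c] card by (metis mult_left_cancel less_numeral_extra(3))
  next
    fix h assume "\<forall>c\<in>coxeter_elements A ?J. group.ord (weyl_group A ?J) c = h"
    with c show "h = group.ord (weyl_group A ?J) (reflection_product A js)" by metis
  qed
  then show ?thesis using order[OF c] by simp
qed

end

theorem proposition1p7:
  fixes A :: "int^'n^'n" and c :: "int^'n \<Rightarrow> int^'n" and i :: 'n
  assumes "cartan_finite_type A"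
    and "c \<in> coxeter_elements A UNIV"
  shows "star A i \<in> coxeter_component A i \<and>
         chain_length A c i + chain_length A c (star A i) = coxeter_number A (coxeter_component A i)"
proof -
  obtain d where d: "finite_type_cartan A d"
    using assms(1) unfolding cartan_finite_type_def finite_type_cartan_def by blast
  obtain w where w: "c = reflection_product A w" "distinct w" "set w = UNIV"
    using assms(2) unfolding coxeter_elements_def by blast
  interpret coxeter_word A d w
    using d w by (intro coxeter_word.intro coxeter_word_axioms.intro)
  have "card (coxeter_component A i) > 0" using in_component by (auto simp: card_gt_0_iff)
  moreover have "card (coxeter_component A i) * coxeter_number A (coxeter_component A i)
      = card (coxeter_component A i) * (chain_length A c i + chain_length A c (star A i))"
    unfolding coxeter_number_component w(1) by (rule card_component_roots[OF period_fundamental])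
  ultimately show ?thesis using star_in_component[of i] by auto
qed

end
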